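(* Let $(\Omega,\mu)$ be a probability space, let $1\le p<2<q\le\infty$, and let $\mathcal D_N=\{g_i\}_{i=1}^N$ be a system of $N$ functions in $L_q(\Omega,\mu)$. Set $\theta:=\big(\frac12-\frac1q\big)/\big(\frac1p-\frac1q\big)$ and $a=a(\theta):=2^{\frac{\theta}{1-\theta}}$. Then for every $v=1,2,\dots,N$ and every $\varepsilon>0$, $$\mathcal H_\varepsilon(\Sigma_v^p(\mathcal D_N);L_q)\le\sum_{s=0}^\infty\mathcal H_{2^{-3}a^{s-1}\varepsilon^\theta}(\Sigma_{2v}^2(\mathcal D_N);L_q)+\mathcal H_{\varepsilon^\theta}(\Sigma_{2v}^2(\mathcal D_N);L_q).$$
   Context: $L_r=L_r(\Omega,\mu)$ is the real Lebesgue space with norm $\|\cdot\|_r$, $1\le r\le\infty$, and $1/\infty=0$. Every $f\in\operatorname{span}(\mathcal D_N)$ with zero norm is $0\in\operatorname{span}(\mathcal D_N)$. For $1\le v\le N$, $\Sigma_v(\mathcal D_N)$ is the set of all $f=\sum_{i\in G}c_ig_i$ with $G\subset\{1,\dots,N\}$, $|G|=v$, and arbitrary real $c_i$; for $v>N$ one sets $\Sigma_v(\mathcal D_N):=\operatorname{span}(\mathcal D_N)$. For $1\le r\le\infty$, $\Sigma_v^r(\mathcal D_N):=\{f\in\Sigma_v(\mathcal D_N):\|f\|_r\le1\}$. For a compact subset $A$ of a Banach space $X$ and $t>0$, $N_t(A,X)$ is the smallest $n\in\mathbb N$ such that there are $g^1,\dots,g^n\in A$ with $A\subset\bigcup_{j=1}^n\{f\in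 X:\|f-g^j\|\le t\}$, and $\mathcal H_t(A;X)=\mathcal H_t(A,X):=\log_2N_t(A,X)$. *)

theory Defs
  imports "HOL-Probability.Probability" "HOL-Probability.Essential_Supremum"
begin

text \<open>
  Elements of \<open>L\<^sub>r\<close> are represented by measurable functions; two functions that agree almost
  everywhere stand for the same element. Functions enter everything below only through
  \<open>Lr_norm\<close>, which does not distinguish such representatives, so an element of the span
  with zero norm is the zero element.
\<close>

definition Lr_space :: "'a measure \<Rightarrow> ennreal \<Rightarrow> ('a \<Rightarrow> real) set" where
  "Lr_space M r = {f \<in> borel_measurable M.
     if r = \<infinity> then \<exists>C. AE x in M. \<bar>f x\<bar> \<le> C
     else integrable M (\<lambda>x. \<bar>f x\<bar> powr enn2real r)}"

text \<open>A norm in the usual sense (up to null functions) on \<open>Lr_space M r\<close>, for \<open>1 \<le> r\<close>.\<close>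

definition Lr_norm :: "'a measure \<Rightarrow> ennreal \<Rightarrow> ('a \<Rightarrow> real) \<Rightarrow> real" where
  "Lr_norm M r f =
     (if r = \<infinity> then real_of_ereal (esssup M (\<lambda>x. ereal \<bar>f x\<bar>))
      else (\<integral>x. \<bar>f x\<bar> powr enn2real r \<partial>M) powr (1 / enn2real r))"

text \<open>
  A system \<open>g 1, \<dots>, g N\<close> is a family, so repetitions and linear dependence are allowed.
\<close>

definition sys_span :: "nat \<Rightarrow> (nat \<Rightarrow> 'a \<Rightarrow> real) \<Rightarrow> ('a \<Rightarrow> real) set" where
  "sys_span N g = {f. \<exists>c. f = (\<lambda>x. \<Sum>i\<in>{1..N}. c i * g i x)}"

definition Sigma_sparse :: "nat \<Rightarrow> (nat \<Rightarrow> 'a \<Rightarrow> real) \<Rightarrow> nat \<Rightarrow> ('a \<Rightarrow> real) set" where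
  "Sigma_sparse N g v =
     (if v \<le> N
      then {f. \<exists>G c. G \<subseteq> {1..N} \<and> card G = v \<and> f = (\<lambda>x. \<Sum>i\<in>G. c i * g i x)}
      else sys_span N g)"

definition Sigma_ball ::
  "'a measure \<Rightarrow> ennreal \<Rightarrow> nat \<Rightarrow> (nat \<Rightarrow> 'a \<Rightarrow> real) \<Rightarrow> nat \<Rightarrow> ('a \<Rightarrow> real) set" where
  "Sigma_ball M r N g v = {f \<in> Sigma_sparse N g v. f \<in> Lr_space M r \<and> Lr_norm M r f \<le> 1}"

text \<open>
  The covering number \<open>N\<^sub>t(A, L\<^sub>q)\<close>, with centres in \<open>A\<close> and closed balls. It is meaningful only
  for \<open>A\<close> that admits a finite cover, in particular for compact \<open>A\<close>.
\<close>

definition covering_number :: "'a measure \<Rightarrow> ennreal \<Rightarrow> real \<Rightarrow> ('a \<Rightarrow> real) set \<Rightarrow> nat" where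
  "covering_number M q t A =
     (LEAST n. \<exists>h :: nat \<Rightarrow> 'a \<Rightarrow> real.
        (\<forall>j\<in>{1..n}. h j \<in> A) \<and>
        A \<subseteq> (\<Union>j\<in>{1..n}. {f \<in> Lr_space M q. Lr_norm M q (\<lambda>x. f x - h j x) \<le> t}))"

definition metric_entropy :: "'a measure \<Rightarrow> ennreal \<Rightarrow> real \<Rightarrow> ('a \<Rightarrow> real) set \<Rightarrow> real" where
  "metric_entropy M q t A = log 2 (real (covering_number M q t A))"

end

theory Submission
  imports Defs
begin

text \<open>
  If two elements \<open>f\<close>, \<open>h\<close> of the sparse \<open>L\<^sub>p\<close>-ball are at \<open>L\<^sub>q\<close>-distance at most \<open>R\<close>, then \<open>f - h\<close> is
  \<open>2v\<close>-sparse with \<open>L\<^sub>p\<close>-norm at most \<open>2\<close>, so by interpolation its \<open>L\<^sub>2\<close>-norm is at most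
  \<open>L = 2 powr \<theta> * R powr (1 - \<theta>)\<close>. Hence an \<open>R\<close>-cover of the \<open>L\<^sub>p\<close>-ball and a \<open>\<tau>\<close>-cover of the
  \<open>2v\<close>-sparse \<open>L\<^sub>2\<close>-ball combine to a \<open>2 L \<tau>\<close>-cover of the \<open>L\<^sub>p\<close>-ball, whose cardinality is at most the
  product of the two. Iterate this along the radii \<open>2 powr (s / (1 - \<theta>)) * \<epsilon>\<close>. On the span of the
  system all norms are equivalent, so the balls are totally bounded and only finitely many
  terms of the series are nonzero.
\<close>

subsection \<open>The spaces \<open>L\<^sub>r\<close> over a probability space\<close>

text \<open>Convexity of the \<open>r\<close>-th power, applied to \<open>\<bar>x\<bar> / A\<close>
  and \<open>\<bar>y\<bar> / B\<close> with weights \<open>A / (A + B)\<close> and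
  \<open>B / (A + B)\<close>. Integrated with \<open>A\<close> and \<open>B\<close> bounding the
  norms of two functions, it becomes Minkowski's inequality, with no appeal to Hoelder.\<close>

lemma abs_add_powr_le:
  fixes x y A B r :: real
  assumes "1 \<le> r" "0 < A" "0 < B"
  shows "\<bar>x + y\<bar> powr r \<le>
    (A + B) powr r * (A / (A + B) * (\<bar>x\<bar> powr r / A powr r) + B / (A + B) * (\<bar>y\<bar> powr r / B powr r))"
proof -
  define s t where "s = A / (A + B)" and "t = B / (A + B)"
  have st: "0 < s" "0 < t" "s + t = 1"
    using assms by (auto simp: s_def t_def add_divide_distrib[symmetric])
  have conv: "(s * u + t * w) powr r \<le> s * u powr r + t * w powr r" if uw: "0 \<le> u" "0 \<le> w" for u w
  proof -
    have less: "c powr r \<le> c" if "0 < c" "c \<le> 1" for c :: real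
      using powr_mono'[of 1 r c] that assms by simp
    \<comment> \<open>Two positive arguments are covered by convexity. If one vanishes, the claim
      reduces to \<open>c powr r \<le> c\<close> for a weight \<open>c\<close>.\<close>
    consider "u = 0" | "w = 0" | "0 < u" "0 < w"
      using uw by linarith
    then show ?thesis
    proof cases
      case 1
      then show ?thesis
        using uw st less[of t] by (auto simp: powr_mult intro!: mult_right_mono)
    next
      case 2
      then show ?thesis
        using uw st less[of s] by (auto simp: powr_mult intro!: mult_right_mono)
    next
      case 3
      then show ?thesis
        using powr_convex[OF assms(1)] st by (auto simp: convex_on_def)
    qed
  qed
  have "\<bar>x + y\<bar> \<le> (A + B) * (s * (\<bar>x\<bar> / A) + t * (\<bar>y\<bar> / B))"
    using assms by (auto simp: s_def t_def distrib_left)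
  then have "\<bar>x + y\<bar> powr r \<le> ((A + B) * (s * (\<bar>x\<bar> / A) + t * (\<bar>y\<bar> / B))) powr r"
    using assms by (intro powr_mono2) auto
  also have "\<dots> = (A + B) powr r * (s * (\<bar>x\<bar> / A) + t * (\<bar>y\<bar> / B)) powr r"
    by (rule powr_mult)
  also have "\<dots> \<le> (A + B) powr r * (s * (\<bar>x\<bar> / A) powr r + t * (\<bar>y\<bar> / B) powr r)"
    using assms by (intro mult_left_mono conv) auto
  finally show ?thesis
    using assms by (simp add: s_def t_def powr_divide)
qed

lemma enn2real_ge_1: "1 \<le> r \<Longrightarrow> r < \<infinity> \<Longrightarrow> 1 \<le> enn2real r"
  by (cases r) (auto simp: one_ennreal.rep_eq ennreal_1[symmetric] simp del: ennreal_1)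

lemma Lr_spaceD_measurable: "f \<in> Lr_space M r \<Longrightarrow> f \<in> borel_measurable M"
  by (simp add: Lr_space_def)

context prob_space
begin

text \<open>Trades the root for a bound on the integral, so that norm estimates can be proved by
  integrating pointwise ones. Only roots of a nonnegative number are involved: for a non-integrable
  power the Bochner integral takes its default value 0.\<close>

lemma Lr_norm_le_iff_finite:
  assumes "1 \<le> r" "r < \<infinity>" "0 \<le> B"
  shows "Lr_norm M r f \<le> B \<longleftrightarrow> (\<integral>x. \<bar>f x\<bar> powr enn2real r \<partial>M) \<le> B powr enn2real r"
proof -
  define \<rho> where "\<rho> = enn2real r"
  have \<rho>: "1 \<le> \<rho>" using enn2real_ge_1 assms by (simp add: \<rho>_def)
  define I where "I = (\<integral>x. \<bar>f x\<bar> powr \<rho> \<partial>M)"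
  have I: "0 \<le> I" by (simp add: I_def)
  have "I powr (1 / \<rho>) \<le> B \<longleftrightarrow> I \<le> B powr \<rho>"
  proof
    assume "I powr (1 / \<rho>) \<le> B"
    then have "(I powr (1 / \<rho>)) powr \<rho> \<le> B powr \<rho>"
      using \<rho> by (intro powr_mono2) auto
    then show "I \<le> B powr \<rho>" using I \<rho> by (simp add: powr_powr)
  next
    assume "I \<le> B powr \<rho>"
    then have "I powr (1 / \<rho>) \<le> (B powr \<rho>) powr (1 / \<rho>)"
      using \<rho> I by (intro powr_mono2) auto
    then show "I powr (1 / \<rho>) \<le> B" using assms \<rho> by (simp add: powr_powr)
  qed
  then show ?thesis using assms(2) by (auto simp: Lr_norm_def I_def \<rho>_def)
qed

text \<open>The norm reads the essential supremum through \<open>real_of_ereal\<close>, which sends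
  infinite values to 0. The proof therefore first shows that the supremum is finite and
  nonnegative.\<close>

lemma Linf_norm_le_iff:
  assumes "f \<in> Lr_space M \<infinity>" "0 \<le> B"
  shows "Lr_norm M \<infinity> f \<le> B \<longleftrightarrow> (AE x in M. \<bar>f x\<bar> \<le> B)"
proof -
  have [measurable]: "f \<in> borel_measurable M"
    using assms by (rule_tac Lr_spaceD_measurable)
  define E where "E = esssup M (\<lambda>x. ereal \<bar>f x\<bar>)"
  obtain C where "AE x in M. \<bar>f x\<bar> \<le> C"
    using assms by (auto simp: Lr_space_def)
  then have "E \<le> ereal C"
    unfolding E_def by (intro esssup_I) auto
  \<comment> \<open>The total mass 1 matters here: on a null space the essential supremum of 0 would
    be minus infinity.\<close>
  moreover have "esssup M (\<lambda>x. 0::ereal) \<le> E"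
    unfolding E_def by (intro esssup_mono) auto
  then have "0 \<le> E"
    by (simp add: esssup_const emeasure_space_1)
  ultimately obtain e where e: "E = ereal e" "0 \<le> e"
    by (cases E) auto
  have "AE x in M. ereal \<bar>f x\<bar> \<le> E"
    unfolding E_def by (rule esssup_AE)
  then have 1: "AE x in M. \<bar>f x\<bar> \<le> e"
    by (simp add: e)
  have "e \<le> B \<longleftrightarrow> (AE x in M. \<bar>f x\<bar> \<le> B)"
  proof
    assume "e \<le> B"
    then show "AE x in M. \<bar>f x\<bar> \<le> B" using 1 by auto
  next
    assume "AE x in M. \<bar>f x\<bar> \<le> B"
    then have "E \<le> ereal B"
      unfolding E_def by (intro esssup_I) auto
    then show "e \<le> B" by (simp add: e)
  qed
  then show ?thesis
    using e by (simp add: Lr_norm_def E_def)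
qed

lemma Lr_norm_nonneg:
  assumes "f \<in> Lr_space M r"
  shows "0 \<le> Lr_norm M r f"
proof (cases "r = \<infinity>")
  case True
  have "esssup M (\<lambda>x. 0::ereal) \<le> esssup M (\<lambda>x. ereal \<bar>f x\<bar>)"
    using Lr_spaceD_measurable[OF assms] by (intro esssup_mono) auto
  then show ?thesis
    using True by (simp add: Lr_norm_def esssup_const emeasure_space_1 real_of_ereal_pos)
qed (simp add: Lr_norm_def)

lemma Linf_AE_le_norm:
  assumes "f \<in> Lr_space M \<infinity>"
  shows "AE x in M. \<bar>f x\<bar> \<le> Lr_norm M \<infinity> f"
  using Linf_norm_le_iff[OF assms, of "Lr_norm M \<infinity> f"] Lr_norm_nonneg[OF assms] by simp

text \<open>Minkowski's inequality. For infinite \<open>r\<close> the almost-everywhere bounds add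
  up; for finite \<open>r\<close> the pointwise convexity bound is integrated.\<close>

lemma Lr_add:
  assumes r: "1 \<le> r" and f: "f \<in> Lr_space M r" and h: "h \<in> Lr_space M r"
  shows "(\<lambda>x. f x + h x) \<in> Lr_space M r"
    and "Lr_norm M r (\<lambda>x. f x + h x) \<le> Lr_norm M r f + Lr_norm M r h"
proof -
  have [measurable]: "f \<in> borel_measurable M" "h \<in> borel_measurable M"
    using f h by (auto intro: Lr_spaceD_measurable)
  have "(\<lambda>x. f x + h x) \<in> Lr_space M r \<and>
    Lr_norm M r (\<lambda>x. f x + h x) \<le> Lr_norm M r f + Lr_norm M r h"
  proof (cases "r = \<infinity>")
    case True
    have ae: "AE x in M. \<bar>f x + h x\<bar> \<le> Lr_norm M r f + Lr_norm M r h"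
      using Linf_AE_le_norm[of f] Linf_AE_le_norm[of h] f h True by auto
    then have "(\<lambda>x. f x + h x) \<in> Lr_space M r"
      using True by (auto simp: Lr_space_def)
    then show ?thesis
      using Linf_norm_le_iff ae Lr_norm_nonneg[OF f] Lr_norm_nonneg[OF h] True by auto
  next
    case False
    then have r': "r < \<infinity>" by (simp add: less_top)
    define \<rho> where "\<rho> = enn2real r"
    have \<rho>: "1 \<le> \<rho>" using enn2real_ge_1 r r' by (simp add: \<rho>_def)
    have If: "integrable M (\<lambda>x. \<bar>f x\<bar> powr \<rho>)" and Ih: "integrable M (\<lambda>x. \<bar>h x\<bar> powr \<rho>)"
      using f h False by (auto simp: Lr_space_def \<rho>_def)
    define U where "U A B x = (A + B) powr \<rho> * (A / (A + B) * (\<bar>f x\<bar> powr \<rho> / A powr \<rho>)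
        + B / (A + B) * (\<bar>h x\<bar> powr \<rho> / B powr \<rho>))" for A B x
    have U: "\<bar>f x + h x\<bar> powr \<rho> \<le> U A B x" if "0 < A" "0 < B" for A B x
      unfolding U_def by (rule abs_add_powr_le) (use \<rho> that in auto)
    have IU: "integrable M (U A B)" for A B
      unfolding U_def using If Ih
      by (intro integrable_mult_right Bochner_Integration.integrable_add integrable_divide)
    \<comment> \<open>Membership comes first, from the convexity bound with
      \<open>A = B = 1\<close>; the sharp constants enter only in the norm estimate.\<close>
    have I: "integrable M (\<lambda>x. \<bar>f x + h x\<bar> powr \<rho>)"
    proof (rule Bochner_Integration.integrable_bound[OF IU])
      show "AE x in M. norm (\<bar>f x + h x\<bar> powr \<rho>) \<le> norm (U 1 1 x)"
        using U[of 1 1] by (auto intro!: AE_I2 order_trans[OF _ abs_ge_self])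
    qed measurable
    \<comment> \<open>Half of \<open>e\<close> is added to each norm so that \<open>A\<close> and
      \<open>B\<close> stay positive even for null functions; \<open>e\<close> then tends to
      0.\<close>
    have "Lr_norm M r (\<lambda>x. f x + h x) \<le> Lr_norm M r f + Lr_norm M r h + e" if "0 < e" for e
    proof -
      define A B where "A = Lr_norm M r f + e / 2" and "B = Lr_norm M r h + e / 2"
      have AB: "0 < A" "0 < B" "Lr_norm M r f \<le> A" "Lr_norm M r h \<le> B"
        using Lr_norm_nonneg[OF f] Lr_norm_nonneg[OF h] that by (auto simp: A_def B_def)
      have fA: "(\<integral>x. \<bar>f x\<bar> powr \<rho> \<partial>M) / A powr \<rho> \<le> 1"
        using Lr_norm_le_iff_finite[of r A f] r r' AB by (simp add: \<rho>_def)
      have hB: "(\<integral>x. \<bar>h x\<bar> powr \<rho> \<partial>M) / B powr \<rho> \<le> 1"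
        using Lr_norm_le_iff_finite[of r B h] r r' AB by (simp add: \<rho>_def)
      have "(\<integral>x. \<bar>f x + h x\<bar> powr \<rho> \<partial>M) \<le> (\<integral>x. U A B x \<partial>M)"
        by (intro integral_mono I IU U AB)
      also have "\<dots> = (A + B) powr \<rho> * (A / (A + B) * ((\<integral>x. \<bar>f x\<bar> powr \<rho> \<partial>M) / A powr \<rho>)
        + B / (A + B) * ((\<integral>x. \<bar>h x\<bar> powr \<rho> \<partial>M) / B powr \<rho>))"
        unfolding U_def using If Ih by simp
      also have "\<dots> \<le> (A + B) powr \<rho> * (A / (A + B) * 1 + B / (A + B) * 1)"
        using AB fA hB by (intro mult_left_mono add_mono) auto
      also have "\<dots> = (A + B) powr \<rho>"
        using AB by (simp add: add_divide_distrib[symmetric])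
      finally have "Lr_norm M r (\<lambda>x. f x + h x) \<le> A + B"
        using Lr_norm_le_iff_finite[of r "A + B" "\<lambda>x. f x + h x"] r r' AB by (simp add: \<rho>_def)
      then show ?thesis by (simp add: A_def B_def)
    qed
    then have "Lr_norm M r (\<lambda>x. f x + h x) \<le> Lr_norm M r f + Lr_norm M r h"
      by (rule field_le_epsilon)
    moreover have "(\<lambda>x. f x + h x) \<in> Lr_space M r"
      using False I by (simp add: Lr_space_def \<rho>_def)
    ultimately show ?thesis by simp
  qed
  then show "(\<lambda>x. f x + h x) \<in> Lr_space M r"
    "Lr_norm M r (\<lambda>x. f x + h x) \<le> Lr_norm M r f + Lr_norm M r h" by auto
qed

lemma Lr_scale:
  assumes r: "1 \<le> r" and f: "f \<in> Lr_space M r"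
  shows "(\<lambda>x. c * f x) \<in> Lr_space M r" and "Lr_norm M r (\<lambda>x. c * f x) \<le> \<bar>c\<bar> * Lr_norm M r f"
proof -
  have [measurable]: "f \<in> borel_measurable M"
    using f by (auto intro: Lr_spaceD_measurable)
  have "(\<lambda>x. c * f x) \<in> Lr_space M r \<and> Lr_norm M r (\<lambda>x. c * f x) \<le> \<bar>c\<bar> * Lr_norm M r f"
  proof (cases "r = \<infinity>")
    case True
    have ae: "AE x in M. \<bar>c * f x\<bar> \<le> \<bar>c\<bar> * Lr_norm M r f"
      using Linf_AE_le_norm[of f] f True by (auto simp: abs_mult elim!: eventually_mono intro: mult_left_mono)
    then have "(\<lambda>x. c * f x) \<in> Lr_space M r"
      using True by (auto simp: Lr_space_def)
    then show ?thesis
      using Linf_norm_le_iff ae Lr_norm_nonneg[OF f] True by auto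
  next
    case False
    then have r': "r < \<infinity>" by (simp add: less_top)
    have "1 \<le> enn2real r" using enn2real_ge_1 r r' by simp
    then show ?thesis
      using f False by (simp add: Lr_space_def Lr_norm_def abs_mult powr_mult powr_powr)
  qed
  then show "(\<lambda>x. c * f x) \<in> Lr_space M r" "Lr_norm M r (\<lambda>x. c * f x) \<le> \<bar>c\<bar> * Lr_norm M r f"
    by auto
qed

lemma Lr_diff:
  assumes r: "1 \<le> r" and f: "f \<in> Lr_space M r" and h: "h \<in> Lr_space M r"
  shows "(\<lambda>x. f x - h x) \<in> Lr_space M r"
    and "Lr_norm M r (\<lambda>x. f x - h x) \<le> Lr_norm M r f + Lr_norm M r h"
  using Lr_add[OF r f Lr_scale(1)[OF r h, of "-1"]] Lr_scale(2)[OF r h, of "-1"] by simp_all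

lemma Lr_norm_AE_cong:
  assumes "f \<in> borel_measurable M" "h \<in> borel_measurable M" "AE x in M. f x = h x"
  shows "Lr_norm M r f = Lr_norm M r h"
proof -
  have [measurable]: "f \<in> borel_measurable M" "h \<in> borel_measurable M" by fact+
  have "esssup M (\<lambda>x. ereal \<bar>f x\<bar>) = esssup M (\<lambda>x. ereal \<bar>h x\<bar>)"
    by (rule esssup_AE_cong) (use assms(3) in auto)
  moreover have "(\<integral>x. \<bar>f x\<bar> powr enn2real r \<partial>M) = (\<integral>x. \<bar>h x\<bar> powr enn2real r \<partial>M)"
    by (rule integral_cong_AE) (use assms(3) in auto)
  ultimately show ?thesis by (simp add: Lr_norm_def)
qed

lemma Lr_zero: "(\<lambda>x. 0) \<in> Lr_space M r" and Lr_norm_zero: "Lr_norm M r (\<lambda>x. 0) = 0"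
  by (auto simp: Lr_space_def Lr_norm_def esssup_const emeasure_space_1 zero_ereal_def[symmetric])

lemma Lr_sum:
  assumes r: "1 \<le> r" and "finite I" and "\<And>i. i \<in> I \<Longrightarrow> f i \<in> Lr_space M r"
  shows "(\<lambda>x. \<Sum>i\<in>I. f i x) \<in> Lr_space M r"
    and "Lr_norm M r (\<lambda>x. \<Sum>i\<in>I. f i x) \<le> (\<Sum>i\<in>I. Lr_norm M r (f i))"
proof -
  have "(\<lambda>x. \<Sum>i\<in>I. f i x) \<in> Lr_space M r \<and>
    Lr_norm M r (\<lambda>x. \<Sum>i\<in>I. f i x) \<le> (\<Sum>i\<in>I. Lr_norm M r (f i))"
    using assms(2,3)
  proof (induction I rule: finite_induct)
    case empty
    then show ?case by (simp add: Lr_zero Lr_norm_zero)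
  next
    case (insert i I)
    then show ?case
      using Lr_add[OF r, of "f i" "\<lambda>x. \<Sum>i\<in>I. f i x"] by force
  qed
  then show "(\<lambda>x. \<Sum>i\<in>I. f i x) \<in> Lr_space M r"
    "Lr_norm M r (\<lambda>x. \<Sum>i\<in>I. f i x) \<le> (\<Sum>i\<in>I. Lr_norm M r (f i))" by auto
qed

text \<open>Finite total mass makes constants integrable, and
  \<open>1 + \<bar>f x\<bar> powr s\<close> dominates the smaller power; for infinite
  \<open>s\<close> a constant dominates.\<close>

lemma Lr_space_mono:
  assumes r: "1 \<le> r" and "r \<le> s" and f: "f \<in> Lr_space M s"
  shows "f \<in> Lr_space M r"
proof -
  have [measurable]: "f \<in> borel_measurable M"
    using f by (auto intro: Lr_spaceD_measurable)
  consider "r = \<infinity>" | "r < \<infinity>" "s = \<infinity>" | "r < \<infinity>" "s < \<infinity>"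
    by (cases "r = \<infinity>"; cases "s = \<infinity>") (simp_all add: less_top)
  then show ?thesis
  proof cases
    case 1
    then show ?thesis using assms by (simp add: top_unique)
  next
    case 2
    then obtain C where C: "AE x in M. \<bar>f x\<bar> \<le> C"
      using f by (auto simp: Lr_space_def)
    have "1 \<le> enn2real r" using enn2real_ge_1 r 2 by simp
    have "integrable M (\<lambda>x. \<bar>f x\<bar> powr enn2real r)"
    proof (rule integrable_const_bound[where B = "\<bar>C\<bar> powr enn2real r"])
      show "AE x in M. norm (\<bar>f x\<bar> powr enn2real r) \<le> \<bar>C\<bar> powr enn2real r"
        using C by eventually_elim (use \<open>1 \<le> enn2real r\<close> in \<open>auto intro!: powr_mono2\<close>)
    qed measurable
    then show ?thesis using 2 by (simp add: Lr_space_def)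
  next
    case 3
    then have le: "1 \<le> enn2real r" "enn2real r \<le> enn2real s"
      using enn2real_ge_1 r assms(2) by (auto intro: enn2real_mono)
    have int: "integrable M (\<lambda>x. 1 + \<bar>f x\<bar> powr enn2real s)"
      using f 3 by (auto simp: Lr_space_def)
    have "integrable M (\<lambda>x. \<bar>f x\<bar> powr enn2real r)"
    proof (rule Bochner_Integration.integrable_bound[OF int])
      have "\<bar>f x\<bar> powr enn2real r \<le> 1 + \<bar>f x\<bar> powr enn2real s" for x
      proof (cases "\<bar>f x\<bar> \<le> 1")
        case True
        then have "\<bar>f x\<bar> powr enn2real r \<le> 1"
          using le by (intro powr_le1) auto
        then show ?thesis by (simp add: add_increasing2)
      next
        case False
        then show ?thesis
          using le powr_mono[of "enn2real r" "enn2real s" "\<bar>f x\<bar>"] by linarith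
      qed
      then show "AE x in M. norm (\<bar>f x\<bar> powr enn2real r) \<le> norm (1 + \<bar>f x\<bar> powr enn2real s)"
        by (auto intro!: AE_I2 order_trans[OF _ abs_ge_self])
    qed measurable
    then show ?thesis using 3 by (simp add: Lr_space_def)
  qed
qed

end

subsection \<open>Interpolation between \<open>L\<^sub>p\<close> and \<open>L\<^sub>q\<close>\<close>

text \<open>The choice of \<open>\<theta>\<close> amounts to 1/2 = \<theta>/p + (1 - \<theta>)/q;
  doubled, this provides the weights for Young's inequality. Infinite \<open>q\<close> is stated
  apart because \<open>enn2real\<close> sends infinity to 0, so that division by
  \<open>enn2real q\<close> would lose its meaning.\<close>

lemma interpolation_exponents:
  fixes p q :: ennreal
  assumes "1 \<le> p" "p < 2" "2 < q"
    and \<theta>: "\<theta> = (1 / 2 - enn2real (1 / q)) / (enn2real (1 / p) - enn2real (1 / q))"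
  shows "0 < \<theta>" "\<theta> < 1" "1 \<le> enn2real p" "enn2real p < 2"
    and "q = \<infinity> \<Longrightarrow> 2 * \<theta> = enn2real p"
    and "q < \<infinity> \<Longrightarrow> 2 < enn2real q"
    and "q < \<infinity> \<Longrightarrow> 2 * \<theta> / enn2real p + 2 * (1 - \<theta>) / enn2real q = 1"
proof -
  have "p < \<infinity>" using assms by (auto intro: order.strict_trans)
  then obtain p' where p': "p = ennreal p'" "0 \<le> p'" by (cases p) auto
  then have p: "1 \<le> p'" "p' < 2" 
    using assms(1,2)
    by (auto simp: ennreal_1[symmetric] ennreal_numeral[symmetric] ennreal_less_iff
        simp del: ennreal_1 ennreal_numeral)
  show "1 \<le> enn2real p" "enn2real p < 2" using p p' by auto
  have ip: "enn2real (1 / p) = 1 / p'"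
    using p p' by (simp add: divide_ennreal ennreal_1[symmetric] del: ennreal_1)
  have "1 / 2 < 1 / p'" using p by (simp add: field_simps)
  have "enn2real (1 / q) < 1 / 2 \<and> (q = \<infinity> \<longrightarrow> 2 * \<theta> = enn2real p) \<and>
    (q < \<infinity> \<longrightarrow> 2 < enn2real q \<and> 2 * \<theta> / enn2real p + 2 * (1 - \<theta>) / enn2real q = 1)"
  proof (cases q)
    case (real q')
    then have q: "2 < q'"
      using assms(3) by (auto simp: ennreal_numeral[symmetric] ennreal_less_iff simp del: ennreal_numeral)
    have iq: "enn2real (1 / q) = 1 / q'"
      using q real by (simp add: divide_ennreal ennreal_1[symmetric] del: ennreal_1)
    define \<alpha> \<beta> where "\<alpha> = 1 / p'" and "\<beta> = 1 / q'"
    have "\<beta> < 1 / 2" "1 / 2 < \<alpha>" using p q by (auto simp: \<alpha>_def \<beta>_def field_simps)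
    moreover have "\<theta> = (1 / 2 - \<beta>) / (\<alpha> - \<beta>)"
      using \<theta> by (simp add: ip iq \<alpha>_def \<beta>_def)
    ultimately have "\<theta> * (\<alpha> - \<beta>) = 1 / 2 - \<beta>"
      by simp
    then have "2 * \<theta> * \<alpha> + 2 * (1 - \<theta>) * \<beta> = 1"
      by (simp add: algebra_simps)
    moreover have "enn2real (1 / q) < 1 / 2"
      unfolding iq using \<open>\<beta> < 1 / 2\<close> by (simp add: \<beta>_def)
    ultimately show ?thesis using q real p' by (simp add: \<alpha>_def \<beta>_def)
  next
    case top
    have "1 / (1 / p') = p'" using p by simp
    then show ?thesis using \<theta> top p p' unfolding ip by simp
  qed
  then have q_half: "enn2real (1 / q) < 1 / 2" and "q = \<infinity> \<Longrightarrow> 2 * \<theta> = enn2real p" "q < \<infinity> \<Longrightarrow> 2 < enn2real q"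
    "q < \<infinity> \<Longrightarrow> 2 * \<theta> / enn2real p + 2 * (1 - \<theta>) / enn2real q = 1"
    by auto
  then show "q = \<infinity> \<Longrightarrow> 2 * \<theta> = enn2real p" "q < \<infinity> \<Longrightarrow> 2 < enn2real q"
    "q < \<infinity> \<Longrightarrow> 2 * \<theta> / enn2real p + 2 * (1 - \<theta>) / enn2real q = 1"
    by auto
  show "0 < \<theta>" "\<theta> < 1"
    using q_half \<open>1 / 2 < 1 / p'\<close> by (auto simp: \<theta> ip intro!: divide_pos_pos)
qed

text \<open>Young's inequality with weights \<open>2 * \<theta> / p\<close> and
  \<open>2 * (1 - \<theta>) / q\<close>, applied to \<open>(\<bar>y\<bar> / A) powr p\<close> and
  \<open>(\<bar>y\<bar> / B) powr q\<close>. After integration both quotients are at most 1 and the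
  weights sum to 1.\<close>

lemma square_le_weighted_powers:
  fixes y A B p q \<theta> :: real
  assumes "0 < A" "0 < B" "0 < p" "0 < q" "0 \<le> \<theta>" "\<theta> \<le> 1"
    and eq: "2 * \<theta> / p + 2 * (1 - \<theta>) / q = 1"
  shows "\<bar>y\<bar> powr 2 \<le> (A powr \<theta> * B powr (1 - \<theta>)) powr 2 *
    (2 * \<theta> / p * (\<bar>y\<bar> powr p / A powr p) + 2 * (1 - \<theta>) / q * (\<bar>y\<bar> powr q / B powr q))"
proof (cases "y = 0")
  case False
  have "(\<bar>y\<bar> / A) powr (2 * \<theta>) * (\<bar>y\<bar> / B) powr (2 * (1 - \<theta>))
    = ((\<bar>y\<bar> / A) powr p) powr (2 * \<theta> / p) * ((\<bar>y\<bar> / B) powr q) powr (2 * (1 - \<theta>) / q)"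
    using assms by (simp add: powr_powr)
  also have "\<dots> \<le> 2 * \<theta> / p * (\<bar>y\<bar> / A) powr p + 2 * (1 - \<theta>) / q * (\<bar>y\<bar> / B) powr q"
    using assms False by (intro Youngs_inequality_0) auto
  finally have le: "(\<bar>y\<bar> / A) powr (2 * \<theta>) * (\<bar>y\<bar> / B) powr (2 * (1 - \<theta>))
    \<le> 2 * \<theta> / p * (\<bar>y\<bar> / A) powr p + 2 * (1 - \<theta>) / q * (\<bar>y\<bar> / B) powr q" .
  have "\<bar>y\<bar> powr 2 = \<bar>y\<bar> powr (2 * \<theta> + 2 * (1 - \<theta>))"
    by (simp add: algebra_simps)
  also have "\<dots> = \<bar>y\<bar> powr (2 * \<theta>) * \<bar>y\<bar> powr (2 * (1 - \<theta>))"
    by (rule powr_add)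
  also have "\<dots> = (A powr \<theta> * B powr (1 - \<theta>)) powr 2 *
      ((\<bar>y\<bar> / A) powr (2 * \<theta>) * (\<bar>y\<bar> / B) powr (2 * (1 - \<theta>)))"
    using assms by (simp add: powr_mult powr_powr powr_divide mult.commute[of _ 2])
  also have "\<dots> \<le> (A powr \<theta> * B powr (1 - \<theta>)) powr 2 *
      (2 * \<theta> / p * (\<bar>y\<bar> / A) powr p + 2 * (1 - \<theta>) / q * (\<bar>y\<bar> / B) powr q)"
    by (intro mult_left_mono le) auto
  finally show ?thesis using assms by (simp add: powr_divide)
qed simp

context prob_space
begin

text \<open>For finite \<open>q\<close> the weighted Young bound is integrated. For infinite
  \<open>q\<close> one has \<open>2 * \<theta> = p\<close>, and the factor
  \<open>\<bar>f x\<bar> powr (2 - p)\<close> is bounded by its value at \<open>B\<close>. Positive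
  bounds \<open>A\<close>, \<open>B\<close> replace the norms themselves, which avoids dividing by a
  zero norm.\<close>

lemma Lr_norm_interpolation:
  assumes p: "1 \<le> p" "p < 2" and q: "2 < q"
    and \<theta>: "\<theta> = (1 / 2 - enn2real (1 / q)) / (enn2real (1 / p) - enn2real (1 / q))"
    and f: "f \<in> Lr_space M q"
    and AB: "0 < A" "0 < B" "Lr_norm M p f \<le> A" "Lr_norm M q f \<le> B"
  shows "Lr_norm M 2 f \<le> A powr \<theta> * B powr (1 - \<theta>)"
proof -
  note exps = interpolation_exponents[OF p q \<theta>]
  define p' q' where "p' = enn2real p" and "q' = enn2real q"
  have [measurable]: "f \<in> borel_measurable M"
    using f by (auto intro: Lr_spaceD_measurable)
  have "p < \<infinity>" using p by (auto intro: order.strict_trans)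
  have "p \<le> q" "2 \<le> q" "1 \<le> q" using p q by auto
  have "f \<in> Lr_space M p" "f \<in> Lr_space M 2"
    using Lr_space_mono[OF _ _ f] p \<open>p \<le> q\<close> \<open>2 \<le> q\<close> by auto
  then have Ip: "integrable M (\<lambda>x. \<bar>f x\<bar> powr p')" and I2: "integrable M (\<lambda>x. \<bar>f x\<bar> powr 2)"
    using \<open>p < \<infinity>\<close> by (auto simp: Lr_space_def p'_def)
  have fA: "(\<integral>x. \<bar>f x\<bar> powr p' \<partial>M) \<le> A powr p'"
    using Lr_norm_le_iff_finite[of p A f] p \<open>p < \<infinity>\<close> AB by (simp add: p'_def)
  have "(\<integral>x. \<bar>f x\<bar> powr 2 \<partial>M) \<le> (A powr \<theta> * B powr (1 - \<theta>)) powr 2"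
  proof (cases "q = \<infinity>")
    case True
    have 2: "2 * \<theta> = p'" using exps True by (simp add: p'_def)
    have "AE x in M. \<bar>f x\<bar> \<le> B"
      using Linf_AE_le_norm[of f] f AB(4) True by auto
    then have "AE x in M. \<bar>f x\<bar> powr 2 \<le> \<bar>f x\<bar> powr p' * B powr (2 - p')"
    proof eventually_elim
      case (elim x)
      have "\<bar>f x\<bar> powr 2 = \<bar>f x\<bar> powr p' * \<bar>f x\<bar> powr (2 - p')"
        by (simp add: powr_add[symmetric])
      also have "\<dots> \<le> \<bar>f x\<bar> powr p' * B powr (2 - p')"
        using elim exps by (intro mult_left_mono powr_mono2) (auto simp: p'_def)
      finally show ?case .
    qed
    then have "(\<integral>x. \<bar>f x\<bar> powr 2 \<partial>M) \<le> (\<integral>x. \<bar>f x\<bar> powr p' * B powr (2 - p') \<partial>M)"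
      using I2 Ip by (intro integral_mono_AE) auto
    also have "\<dots> \<le> A powr p' * B powr (2 - p')"
      using fA by (simp add: mult_right_mono)
    also have "\<dots> = (A powr \<theta> * B powr (1 - \<theta>)) powr 2"
      using AB 2[symmetric] by (simp add: powr_mult powr_powr algebra_simps)
    finally show ?thesis .
  next
    case False
    then have q': "q < \<infinity>" by (simp add: less_top)
    have Iq: "integrable M (\<lambda>x. \<bar>f x\<bar> powr q')"
      using f q' by (auto simp: Lr_space_def q'_def)
    have fB: "(\<integral>x. \<bar>f x\<bar> powr q' \<partial>M) \<le> B powr q'"
      using Lr_norm_le_iff_finite[of q B f] \<open>1 \<le> q\<close> q' AB by (simp add: q'_def)
    define U where "U x = (A powr \<theta> * B powr (1 - \<theta>)) powr 2 *
      (2 * \<theta> / p' * (\<bar>f x\<bar> powr p' / A powr p') + 2 * (1 - \<theta>) / q' * (\<bar>f x\<bar> powr q' / B powr q'))" for x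
    have eq: "2 * \<theta> / p' + 2 * (1 - \<theta>) / q' = 1"
      using exps q' by (simp add: p'_def q'_def)
    have pos: "0 < p'" "0 < q'" using exps q' by (auto simp: p'_def q'_def)
    have IU: "integrable M U"
      unfolding U_def using Ip Iq
      by (intro integrable_mult_right Bochner_Integration.integrable_add integrable_divide)
    have "(\<integral>x. \<bar>f x\<bar> powr 2 \<partial>M) \<le> (\<integral>x. U x \<partial>M)"
      using I2 IU
    proof (rule integral_mono)
      show "\<bar>f x\<bar> powr 2 \<le> U x" for x
        unfolding U_def using exps pos AB eq by (intro square_le_weighted_powers) auto
    qed
    also have "\<dots> = (A powr \<theta> * B powr (1 - \<theta>)) powr 2 *
      (2 * \<theta> / p' * ((\<integral>x. \<bar>f x\<bar> powr p' \<partial>M) / A powr p')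
       + 2 * (1 - \<theta>) / q' * ((\<integral>x. \<bar>f x\<bar> powr q' \<partial>M) / B powr q'))"
      unfolding U_def using Ip Iq by simp
    also have "\<dots> \<le> (A powr \<theta> * B powr (1 - \<theta>)) powr 2 * (2 * \<theta> / p' * 1 + 2 * (1 - \<theta>) / q' * 1)"
      using AB exps pos fA fB by (intro mult_left_mono add_mono) auto
    also have "\<dots> = (A powr \<theta> * B powr (1 - \<theta>)) powr 2"
      using eq by simp
    finally show ?thesis .
  qed
  then show ?thesis
    using Lr_norm_le_iff_finite[of 2 "A powr \<theta> * B powr (1 - \<theta>)" f] by simp
qed

end

subsection \<open>Finite-dimensional subspaces\<close>

text \<open>The index set is a parameter so that an orthonormal basis can be built by induction on
  it.\<close>

definition lin_span :: "'i set \<Rightarrow> ('i \<Rightarrow> 'a \<Rightarrow> real) \<Rightarrow> ('a \<Rightarrow> real) set" where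
  "lin_span I g = {f. \<exists>c. f = (\<lambda>x. \<Sum>i\<in>I. c i * g i x)}"

text \<open>Centres form a set rather than an enumerated family, which makes products and images of
  covers easy to count. Membership of the covered points in \<open>L\<^sub>q\<close> is supplied
  separately, by assuming \<open>A \<subseteq> Lr_space M q\<close>.\<close>

definition finite_cover ::
  "'a measure \<Rightarrow> ennreal \<Rightarrow> real \<Rightarrow> ('a \<Rightarrow> real) set \<Rightarrow> ('a \<Rightarrow> real) set \<Rightarrow> bool" where
  "finite_cover M q t A C \<longleftrightarrow>
     finite C \<and> C \<subseteq> A \<and> (\<forall>f\<in>A. \<exists>h\<in>C. Lr_norm M q (\<lambda>x. f x - h x) \<le> t)"

context prob_space
begin

lemma lin_span_Lr:
  assumes "1 \<le> r" "finite I" "\<And>i. i \<in> I \<Longrightarrow> g i \<in> Lr_space M r" "f \<in> lin_span I g"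
  shows "f \<in> Lr_space M r"
  using assms by (auto simp: lin_span_def intro!: Lr_sum(1) Lr_scale(1))

section \<open>Orthonormal systems in \<open>L\<^sub>2\<close> and their coordinates\<close>

lemma L2_integrable_mult:
  assumes f: "f \<in> Lr_space M 2" and h: "h \<in> Lr_space M 2"
  shows "integrable M (\<lambda>x. f x * h x :: real)"
proof -
  have [measurable]: "f \<in> borel_measurable M" "h \<in> borel_measurable M"
    using f h by (auto intro: Lr_spaceD_measurable)
  have int: "integrable M (\<lambda>x. (f x)\<^sup>2 + (h x)\<^sup>2)"
    using f h by (auto simp: Lr_space_def)
  show ?thesis
  proof (rule Bochner_Integration.integrable_bound[OF int])
    have "\<bar>f x * h x\<bar> \<le> (f x)\<^sup>2 + (h x)\<^sup>2" for x
    proof -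
      have "2 * (\<bar>f x\<bar> * \<bar>h x\<bar>) \<le> (f x)\<^sup>2 + (h x)\<^sup>2"
        using sum_squares_bound[of "\<bar>f x\<bar>" "\<bar>h x\<bar>"] by simp
      moreover have "0 \<le> \<bar>f x\<bar> * \<bar>h x\<bar>" by simp
      ultimately show ?thesis unfolding abs_mult by linarith
    qed
    then show "AE x in M. norm (f x * h x) \<le> norm ((f x)\<^sup>2 + (h x)\<^sup>2)"
      by (auto intro!: AE_I2)
  qed measurable
qed

lemma L2_norm_eq: "Lr_norm M 2 f = sqrt (\<integral>x. f x * f x \<partial>M)"
  by (simp add: Lr_norm_def powr_half_sqrt power2_eq_square)

definition orthonormal :: "('a \<Rightarrow> real) set \<Rightarrow> bool" where
  "orthonormal E \<longleftrightarrow> finite E \<and>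
     (\<forall>e\<in>E. \<forall>e'\<in>E. (\<integral>x. e x * e' x \<partial>M) = (if e = e' then 1 else 0))"

lemma integral_orthonormal_sum_mult:
  assumes E: "orthonormal E" "E \<subseteq> Lr_space M 2" and "e' \<in> E"
  shows "(\<integral>x. (\<Sum>e\<in>E. d e * e x) * e' x \<partial>M) = d e'"
proof -
  have "(\<integral>x. (\<Sum>e\<in>E. d e * e x) * e' x \<partial>M) = (\<integral>x. (\<Sum>e\<in>E. d e * (e x * e' x)) \<partial>M)"
    by (simp add: sum_distrib_right mult.assoc)
  also have "\<dots> = (\<Sum>e\<in>E. d e * (\<integral>x. e x * e' x \<partial>M))"
    using assms by (subst Bochner_Integration.integral_sum) (auto intro!: L2_integrable_mult)
  also have "\<dots> = (\<Sum>e\<in>E. if e = e' then d e' else 0)"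
    using assms by (intro sum.cong) (auto simp: orthonormal_def)
  also have "\<dots> = d e'"
    using assms by (simp add: orthonormal_def)
  finally show ?thesis .
qed

text \<open>By Parseval's identity the squared norm is the sum of the squared coefficients, and each
  of them is at most that sum.\<close>

lemma L2_norm_orthonormal_sum_ge:
  assumes E: "orthonormal E" "E \<subseteq> Lr_space M 2" and "e' \<in> E"
  shows "\<bar>d e'\<bar> \<le> Lr_norm M 2 (\<lambda>x. \<Sum>e\<in>E. d e * e x)"
proof -
  define s where "s = (\<lambda>x. \<Sum>e\<in>E. d e * e x)"
  have fin: "finite E" using E by (simp add: orthonormal_def)
  have s: "s \<in> Lr_space M 2"
    unfolding s_def using fin E by (intro Lr_sum Lr_scale) auto
  have "(\<integral>x. s x * s x \<partial>M) = (\<integral>x. (\<Sum>e\<in>E. d e * (s x * e x)) \<partial>M)"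
    by (subst (2) s_def) (simp add: sum_distrib_left mult_ac)
  also have "\<dots> = (\<Sum>e\<in>E. d e * (\<integral>x. s x * e x \<partial>M))"
    using E s by (subst Bochner_Integration.integral_sum) (auto intro!: L2_integrable_mult)
  also have "\<dots> = (\<Sum>e\<in>E. d e * d e)"
    unfolding s_def using E by (intro sum.cong) (auto simp: integral_orthonormal_sum_mult)
  finally have "(\<integral>x. s x * s x \<partial>M) = (\<Sum>e\<in>E. d e * d e)" .
  moreover have "d e' * d e' \<le> (\<Sum>e\<in>E. d e * d e)"
    using assms fin by (intro member_le_sum) auto
  ultimately have "sqrt (d e' * d e') \<le> Lr_norm M 2 s"
    unfolding L2_norm_eq by (intro real_sqrt_le_mono) simp
  then show ?thesis by (simp add: s_def)
qed

text \<open>Gram-Schmidt by induction on the index set. Representations hold only almost everywhere,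
  since a residual of zero norm is a null function but need not vanish identically. The basis stays
  in \<open>L\<^sub>q\<close> because each residual is a combination of functions from
  there.\<close>

lemma ex_orthonormal_basis:
  assumes q: "2 \<le> q" and "finite I" and "\<And>i. i \<in> I \<Longrightarrow> g i \<in> Lr_space M q"
  shows "\<exists>E. orthonormal E \<and> E \<subseteq> Lr_space M q \<and>
    (\<forall>f\<in>lin_span I g. \<exists>d. AE x in M. f x = (\<Sum>e\<in>E. d e * e x))"
  using assms(2,3)
proof (induction I rule: finite_induct)
  case empty
  show ?case by (rule exI[of _ "{}"]) (auto simp: orthonormal_def lin_span_def)
next
  case (insert j I)
  have q1: "1 \<le> q" by (rule order_trans[OF _ q]) simp
  obtain E where E: "orthonormal E" "E \<subseteq> Lr_space M q"
    and rep: "\<And>f. f \<in> lin_span I g \<Longrightarrow> \<exists>d. AE x in M. f x = (\<Sum>e\<in>E. d e * e x)"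
    using insert.IH insert.prems by blast
  have fin: "finite E" using E by (simp add: orthonormal_def)
  have L2: "f \<in> Lr_space M 2" if "f \<in> Lr_space M q" for f
    using Lr_space_mono[OF _ q that] by simp
  have E2: "E \<subseteq> Lr_space M 2" using E L2 by auto
  have gj: "g j \<in> Lr_space M q" using insert by auto
  define b where "b e = (\<integral>x. g j x * e x \<partial>M)" for e
  \<comment> \<open>The residual of \<open>g j\<close> after subtracting its orthogonal projection
    onto the span of \<open>E\<close>.\<close>
  define w where "w = (\<lambda>x. g j x - (\<Sum>e\<in>E. b e * e x))"
  have w: "w \<in> Lr_space M q"
    unfolding w_def using q1 fin E gj by (intro Lr_diff Lr_sum Lr_scale) auto
  then have [measurable]: "w \<in> borel_measurable M" by (rule Lr_spaceD_measurable)
  have orth: "(\<integral>x. w x * e x \<partial>M) = 0" if "e \<in> E" for e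
  proof -
    have S: "(\<lambda>x. \<Sum>e\<in>E. b e * e x) \<in> Lr_space M 2"
      using fin E2 by (intro Lr_sum Lr_scale) auto
    have "(\<integral>x. w x * e x \<partial>M) = (\<integral>x. g j x * e x \<partial>M) - (\<integral>x. (\<Sum>e\<in>E. b e * e x) * e x \<partial>M)"
      unfolding w_def left_diff_distrib
      using L2_integrable_mult[OF S, of e] L2_integrable_mult[OF L2[OF gj], of e] that E2
      by (intro Bochner_Integration.integral_diff) auto
    then show ?thesis
      using integral_orthonormal_sum_mult[OF E(1) E2 that, of b] by (simp add: b_def)
  qed
  have split: "\<exists>c d. AE x in M. f x = c * w x + (\<Sum>e\<in>E. d e * e x)"
    if f: "f \<in> lin_span (insert j I) g" for f
  proof -
    obtain c where c: "f = (\<lambda>x. \<Sum>i\<in>insert j I. c i * g i x)"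
      using f by (auto simp: lin_span_def)
    obtain d where "AE x in M. (\<Sum>i\<in>I. c i * g i x) = (\<Sum>e\<in>E. d e * e x)"
      using rep[of "\<lambda>x. \<Sum>i\<in>I. c i * g i x"] by (auto simp: lin_span_def)
    then have "AE x in M. f x = c j * w x + (\<Sum>e\<in>E. (c j * b e + d e) * e x)"
      by eventually_elim
        (use insert.hyps in \<open>simp add: c w_def sum.distrib algebra_simps sum_distrib_left\<close>)
    then show ?thesis
      by (intro exI[of _ "c j"] exI[of _ "\<lambda>e. c j * b e + d e"])
  qed
  define n where "n = (\<integral>x. w x * w x \<partial>M)"
  show ?case
  \<comment> \<open>A null residual adds no dimension, so \<open>E\<close> is kept; otherwise the
    normalised residual joins \<open>E\<close>.\<close>
  proof (cases "n = 0")
    case True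
    then have w0: "AE x in M. w x = 0"
      using L2_integrable_mult[OF L2[OF w] L2[OF w]] unfolding n_def
      by (subst (asm) integral_nonneg_eq_0_iff_AE) auto
    have "\<exists>d. AE x in M. f x = (\<Sum>e\<in>E. d e * e x)" if f: "f \<in> lin_span (insert j I) g" for f
    proof -
      obtain c d where "AE x in M. f x = c * w x + (\<Sum>e\<in>E. d e * e x)"
        using split[OF f] by blast
      with w0 have "AE x in M. f x = (\<Sum>e\<in>E. d e * e x)" by eventually_elim simp
      then show ?thesis by blast
    qed
    then show ?thesis using E by blast
  next
    case False
    then have n: "0 < n" 
      by (simp add: n_def less_le)
    define u where "u = (\<lambda>x. (1 / sqrt n) * w x)"
    have u: "u \<in> Lr_space M q"
      unfolding u_def by (intro Lr_scale q1 w)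
    have ue: "(\<integral>x. u x * e x \<partial>M) = 0" "(\<integral>x. e x * u x \<partial>M) = 0" if "e \<in> E" for e
      using orth[OF that] by (simp_all add: u_def mult_ac)
    have uu: "(\<integral>x. u x * u x \<partial>M) = 1"
    proof -
      have "(\<integral>x. u x * u x \<partial>M) = (\<integral>x. (1 / n) * (w x * w x) \<partial>M)"
        using n by (intro Bochner_Integration.integral_cong) (auto simp: u_def field_simps)
      also have "\<dots> = 1 / n * n" by (simp add: n_def)
      finally show ?thesis using n by simp
    qed
    \<comment> \<open>Were \<open>u\<close> in \<open>E\<close>, its inner product with itself would
      be both 0 and 1.\<close>
    have "u \<notin> E" using ue uu by force
    have "orthonormal (insert u E)"
      using E(1) ue uu \<open>u \<notin> E\<close> unfolding orthonormal_def by auto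
    moreover have "\<exists>d. AE x in M. f x = (\<Sum>e\<in>insert u E. d e * e x)"
      if f: "f \<in> lin_span (insert j I) g" for f
    proof -
      obtain c d where "AE x in M. f x = c * w x + (\<Sum>e\<in>E. d e * e x)"
        using split[OF f] by blast
      then have "AE x in M. f x = (\<Sum>e\<in>insert u E. (d(u := c * sqrt n)) e * e x)"
      proof eventually_elim
        case (elim x)
        have "(\<Sum>e\<in>E. (d(u := c * sqrt n)) e * e x) = (\<Sum>e\<in>E. d e * e x)"
          using \<open>u \<notin> E\<close> by (intro sum.cong) auto
        then show ?case
          using elim n fin \<open>u \<notin> E\<close> by (simp add: u_def)
      qed
      then show ?thesis by blast
    qed
    ultimately show ?thesis using E u by blast
  qed
qed

text \<open>Serves both the comparison of norms and total boundedness. The coordinates are merely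
  chosen for each function, so later arguments subtract coordinates of two functions and do not rely
  on linearity in \<open>f\<close>.\<close>

lemma lin_span_bounded_coordinates:
  assumes q: "2 \<le> q" and I: "finite I" and g: "\<And>i. i \<in> I \<Longrightarrow> g i \<in> Lr_space M q"
  shows "\<exists>E d. finite E \<and> E \<subseteq> Lr_space M q \<and>
    (\<forall>f\<in>lin_span I g. (AE x in M. f x = (\<Sum>e\<in>E. d f e * e x)) \<and>
      (\<forall>e\<in>E. \<bar>d f e\<bar> \<le> Lr_norm M 2 f))"
proof -
  obtain E where E: "orthonormal E" "E \<subseteq> Lr_space M q"
    and ex: "\<forall>f\<in>lin_span I g. \<exists>d. AE x in M. f x = (\<Sum>e\<in>E. d e * e x)"
    using ex_orthonormal_basis[of q I g, OF assms] by auto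
  then obtain d where d: "\<And>f. f \<in> lin_span I g \<Longrightarrow> AE x in M. f x = (\<Sum>e\<in>E. d f e * e x)"
    using bchoice[OF ex] by blast
  have q1: "1 \<le> q" by (rule order_trans[OF _ q]) simp
  have fin: "finite E" using E by (simp add: orthonormal_def)
  have E2: "E \<subseteq> Lr_space M 2"
    using E Lr_space_mono[OF _ q] by auto
  have "\<bar>d f e\<bar> \<le> Lr_norm M 2 f" if "f \<in> lin_span I g" "e \<in> E" for f e
  proof -
    have "(\<lambda>x. \<Sum>e\<in>E. d f e * e x) \<in> Lr_space M 2"
      using fin E2 by (intro Lr_sum Lr_scale) auto
    then have "Lr_norm M 2 f = Lr_norm M 2 (\<lambda>x. \<Sum>e\<in>E. d f e * e x)"
      using d[OF that(1)] lin_span_Lr[OF q1 I g that(1)]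
      by (intro Lr_norm_AE_cong) (auto intro: Lr_spaceD_measurable)
    then show ?thesis
      using L2_norm_orthonormal_sum_ge[OF E(1) E2 that(2)] by simp
  qed
  then show ?thesis using fin E d by blast
qed

lemma Lr_norm_lincomb_le:
  assumes q: "1 \<le> q" and E: "finite E" "E \<subseteq> Lr_space M q"
    and f: "f \<in> borel_measurable M" "AE x in M. f x = (\<Sum>e\<in>E. d e * e x)"
    and d: "\<And>e. e \<in> E \<Longrightarrow> \<bar>d e\<bar> \<le> R"
  shows "Lr_norm M q f \<le> R * (\<Sum>e\<in>E. Lr_norm M q e)"
proof -
  have "(\<lambda>x. \<Sum>e\<in>E. d e * e x) \<in> Lr_space M q"
    using q E by (intro Lr_sum Lr_scale) auto
  then have "Lr_norm M q f = Lr_norm M q (\<lambda>x. \<Sum>e\<in>E. d e * e x)"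
    using f by (intro Lr_norm_AE_cong) (auto intro: Lr_spaceD_measurable)
  also have "\<dots> \<le> (\<Sum>e\<in>E. Lr_norm M q (\<lambda>x. d e * e x))"
    using q E by (intro Lr_sum Lr_scale) auto
  also have "\<dots> \<le> (\<Sum>e\<in>E. R * Lr_norm M q e)"
  proof (rule sum_mono)
    fix e assume "e \<in> E"
    then have e: "e \<in> Lr_space M q" using E by auto
    show "Lr_norm M q (\<lambda>x. d e * e x) \<le> R * Lr_norm M q e"
      using Lr_scale(2)[OF q e, of "d e"] mult_right_mono[OF d[OF \<open>e \<in> E\<close>] Lr_norm_nonneg[OF e]]
      by linarith
  qed
  finally show ?thesis by (simp add: sum_distrib_left)
qed

lemma Lr_norm_le_L2_norm_on_span:
  assumes q: "2 \<le> q" and I: "finite I" and g: "\<And>i. i \<in> I \<Longrightarrow> g i \<in> Lr_space M q"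
  obtains K where "0 < K" "\<And>f. f \<in> lin_span I g \<Longrightarrow> Lr_norm M q f \<le> K * Lr_norm M 2 f"
proof -
  have q1: "1 \<le> q" by (rule order_trans[OF _ q]) simp
  obtain E d where E: "finite E" "E \<subseteq> Lr_space M q"
    and d: "\<And>f. f \<in> lin_span I g \<Longrightarrow> AE x in M. f x = (\<Sum>e\<in>E. d f e * e x)"
      "\<And>f e. f \<in> lin_span I g \<Longrightarrow> e \<in> E \<Longrightarrow> \<bar>d f e\<bar> \<le> Lr_norm M 2 f"
    using lin_span_bounded_coordinates[of q I g, OF q I g] by blast
  \<comment> \<open>The summand 1 keeps \<open>K\<close> positive when the basis is empty.\<close>
  define K where "K = 1 + (\<Sum>e\<in>E. Lr_norm M q e)"
  have K: "0 \<le> (\<Sum>e\<in>E. Lr_norm M q e)"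
    using E Lr_norm_nonneg by (intro sum_nonneg) auto
  show thesis
  proof
    show "0 < K" using K by (simp add: K_def)
    fix f assume f: "f \<in> lin_span I g"
    have fq: "f \<in> Lr_space M q" using lin_span_Lr[OF q1 I g f] .
    have "Lr_norm M q f \<le> Lr_norm M 2 f * (\<Sum>e\<in>E. Lr_norm M q e)"
      using fq by (intro Lr_norm_lincomb_le[OF q1 E _ d(1)[OF f] d(2)[OF f]] Lr_spaceD_measurable)
    also have "\<dots> \<le> K * Lr_norm M 2 f"
      using Lr_norm_nonneg[OF Lr_space_mono[OF _ q fq]] by (simp add: K_def algebra_simps)
    finally show "Lr_norm M q f \<le> K * Lr_norm M 2 f" .
  qed
qed

text \<open>Coordinate space is cut into cubes of side \<open>\<delta>\<close>. Bounded coordinates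
  meet finitely many cubes, and one member of \<open>S\<close> is kept from each cube that
  \<open>S\<close> meets, so the centres lie in \<open>S\<close>.\<close>

lemma lin_span_totally_bounded:
  assumes q: "2 \<le> q" and I: "finite I" and g: "\<And>i. i \<in> I \<Longrightarrow> g i \<in> Lr_space M q"
    and S: "S \<subseteq> lin_span I g" "\<And>f. f \<in> S \<Longrightarrow> Lr_norm M 2 f \<le> R" and t: "0 < t"
  shows "\<exists>C. finite_cover M q t S C"
proof -
  have q1: "1 \<le> q" by (rule order_trans[OF _ q]) simp
  obtain E d where E: "finite E" "E \<subseteq> Lr_space M q"
    and d: "\<And>f. f \<in> lin_span I g \<Longrightarrow> AE x in M. f x = (\<Sum>e\<in>E. d f e * e x)"
      "\<And>f e. f \<in> lin_span I g \<Longrightarrow> e \<in> E \<Longrightarrow> \<bar>d f e\<bar> \<le> Lr_norm M 2 f"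
    using lin_span_bounded_coordinates[of q I g, OF q I g] by blast
  define K where "K = 1 + (\<Sum>e\<in>E. Lr_norm M q e)"
  have "0 \<le> (\<Sum>e\<in>E. Lr_norm M q e)"
    using E Lr_norm_nonneg by (intro sum_nonneg) auto
  then have K: "0 < K" "(\<Sum>e\<in>E. Lr_norm M q e) \<le> K" by (auto simp: K_def)
  \<comment> \<open>With this mesh, functions in one cube differ in \<open>L\<^sub>q\<close> by at
    most \<open>\<delta> * K = t\<close>.\<close>
  define \<delta> where "\<delta> = t / K"
  have \<delta>: "0 < \<delta>" using K t by (simp add: \<delta>_def)
  define key where "key f = restrict (\<lambda>e. \<lfloor>d f e / \<delta>\<rfloor>) E" for f
  have "key f \<in> (\<Pi>\<^sub>E e\<in>E. {\<lfloor>- R / \<delta>\<rfloor>..\<lfloor>R / \<delta>\<rfloor>})" if "f \<in> S" for f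
  proof -
    have "- R / \<delta> \<le> d f e / \<delta>" "d f e / \<delta> \<le> R / \<delta>" if "e \<in> E" for e
    proof -
      have "\<bar>d f e\<bar> \<le> R"
        using d(2)[of f e] S \<open>f \<in> S\<close> that by force
      then show "- R / \<delta> \<le> d f e / \<delta>" "d f e / \<delta> \<le> R / \<delta>"
        using \<delta> by (intro divide_right_mono; linarith)+
    qed
    then show ?thesis
      unfolding key_def by (intro restrict_PiE_iff[THEN iffD2] ballI)
        (auto intro!: floor_mono simp del: minus_divide_left)
  qed
  then have "finite (key ` S)"
    using E by (intro finite_subset[OF _ finite_PiE[of E "\<lambda>_. {\<lfloor>- R / \<delta>\<rfloor>..\<lfloor>R / \<delta>\<rfloor>}"]]) auto
  then obtain C where C: "C \<subseteq> S" "finite C" "key ` S = key ` C"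
    using finite_subset_image[of "key ` S" key S] by auto
  have "\<exists>h\<in>C. Lr_norm M q (\<lambda>x. f x - h x) \<le> t" if f: "f \<in> S" for f
  proof -
    obtain h where h: "h \<in> C" "key h = key f"
      using C f by (metis imageE imageI)
    have fh: "f \<in> lin_span I g" "h \<in> lin_span I g" using f h C S by auto
    have ae: "AE x in M. f x - h x = (\<Sum>e\<in>E. (d f e - d h e) * e x)"
      using d(1)[OF fh(1)] d(1)[OF fh(2)]
      by eventually_elim (simp add: left_diff_distrib sum_subtractf)
    have "\<bar>d f e - d h e\<bar> \<le> \<delta>" if "e \<in> E" for e
    proof -
      have "\<lfloor>d f e / \<delta>\<rfloor> = \<lfloor>d h e / \<delta>\<rfloor>"
        using h(2) that by (metis key_def restrict_apply')
      then have "\<bar>d f e / \<delta> - d h e / \<delta>\<bar> \<le> 1" by linarith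
      then show ?thesis
        using \<delta> by (simp add: diff_divide_distrib[symmetric] abs_divide)
    qed
    moreover have "(\<lambda>x. f x - h x) \<in> Lr_space M q"
      using fh by (intro Lr_diff q1 lin_span_Lr[OF q1 I g])
    ultimately have "Lr_norm M q (\<lambda>x. f x - h x) \<le> \<delta> * (\<Sum>e\<in>E. Lr_norm M q e)"
      by (intro Lr_norm_lincomb_le[OF q1 E _ ae]) (auto intro: Lr_spaceD_measurable)
    also have "\<dots> \<le> \<delta> * K" using \<delta> K by (intro mult_left_mono) auto
    also have "\<dots> = t" using K by (simp add: \<delta>_def)
    finally show ?thesis using h by blast
  qed
  then show ?thesis using C unfolding finite_cover_def by blast
qed

end

subsection \<open>Covers\<close>

lemma finite_cover_image_iff:
  assumes "A \<subseteq> Lr_space M q" "finite J"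
  shows "finite_cover M q t A (h ` J) \<longleftrightarrow> (\<forall>j\<in>J. h j \<in> A) \<and>
    A \<subseteq> (\<Union>j\<in>J. {f \<in> Lr_space M q. Lr_norm M q (\<lambda>x. f x - h j x) \<le> t})"
proof -
  have "(\<exists>k\<in>h ` J. Lr_norm M q (\<lambda>x. f x - k x) \<le> t) \<longleftrightarrow>
      f \<in> (\<Union>j\<in>J. {f \<in> Lr_space M q. Lr_norm M q (\<lambda>x. f x - h j x) \<le> t})" if "f \<in> A" for f
    using assms(1) that by auto
  moreover have "h ` J \<subseteq> A \<longleftrightarrow> (\<forall>j\<in>J. h j \<in> A)" by auto
  ultimately show ?thesis
    using assms(2) unfolding finite_cover_def by (simp add: subset_iff Ball_def)
qed

lemma covering_number_eq_Least:
  assumes "A \<subseteq> Lr_space M q"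
  shows "covering_number M q t A = (LEAST n. \<exists>h :: nat \<Rightarrow> _. finite_cover M q t A (h ` {1..n}))"
  unfolding covering_number_def finite_cover_image_iff[OF assms finite_atLeastAtMost] ..

lemma finite_cover_eq_image:
  assumes "finite_cover M q t A C"
  shows "\<exists>h :: nat \<Rightarrow> _. finite_cover M q t A (h ` {1..card C})"
proof -
  have "finite C" using assms by (simp add: finite_cover_def)
  then obtain h where "bij_betw h {1..card C} C"
    using ex_bij_betw_nat_finite_1 by blast
  then have "h ` {1..card C} = C" by (simp add: bij_betw_def)
  then show ?thesis using assms by (intro exI[of _ h]) simp
qed

lemma covering_number_le_card:
  assumes "finite_cover M q t A C" "A \<subseteq> Lr_space M q"
  shows "covering_number M q t A \<le> card C"
  unfolding covering_number_eq_Least[OF assms(2)]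
  by (rule Least_le) (rule finite_cover_eq_image[OF assms(1)])

text \<open>A finite cover \<open>C\<^sub>0\<close> guarantees that the least number is attained.
  The optimal enumeration is turned into a set, whence an inequality of cardinalities is
  enough.\<close>

lemma ex_finite_cover_card_le_covering_number:
  assumes "finite_cover M q t A C\<^sub>0" "A \<subseteq> Lr_space M q"
  shows "\<exists>C. finite_cover M q t A C \<and> card C \<le> covering_number M q t A"
proof -
  have "\<exists>h :: nat \<Rightarrow> _. finite_cover M q t A (h ` {1..covering_number M q t A})"
    unfolding covering_number_eq_Least[OF assms(2)]
    by (rule LeastI) (rule finite_cover_eq_image[OF assms(1)])
  then obtain h where "finite_cover M q t A (h ` {1..covering_number M q t A})" by blast
  moreover have "card (h ` {1..covering_number M q t A}) \<le> covering_number M q t A"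
    using card_image_le[of "{1..covering_number M q t A}" h] by simp
  ultimately show ?thesis by blast
qed

lemma finite_cover_card_pos:
  assumes "finite_cover M q t A C" "A \<noteq> {}"
  shows "1 \<le> card C"
  using assms by (cases "C = {}") (auto simp: finite_cover_def Suc_le_eq card_gt_0_iff)

text \<open>Keeps the logarithms in the entropy nonnegative and away from
  \<open>log 2 0\<close>.\<close>

lemma covering_number_pos:
  assumes "finite_cover M q t A C" "A \<subseteq> Lr_space M q" "A \<noteq> {}"
  shows "1 \<le> covering_number M q t A"
proof -
  obtain C' where "finite_cover M q t A C'" "card C' \<le> covering_number M q t A"
    using ex_finite_cover_card_le_covering_number[OF assms(1,2)] by blast
  then show ?thesis using finite_cover_card_pos[OF _ assms(3)] by (meson order_trans)
qed

lemma finite_cover_zero: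
  assumes "(\<lambda>x. 0) \<in> A" "\<And>f. f \<in> A \<Longrightarrow> Lr_norm M q f \<le> t"
  shows "finite_cover M q t A {\<lambda>x. 0}"
  using assms by (auto simp: finite_cover_def)

section \<open>Sparse combinations and their differences\<close>

lemma Sigma_sparse_subset_lin_span: "Sigma_sparse N g v \<subseteq> lin_span {1..N} g"
proof (cases "v \<le> N")
  case True
  show ?thesis
  proof
    fix f assume "f \<in> Sigma_sparse N g v"
    then obtain G c where G: "G \<subseteq> {1..N}" and f: "f = (\<lambda>x. \<Sum>i\<in>G. c i * g i x)"
      using True by (auto simp: Sigma_sparse_def)
    have "f = (\<lambda>x. \<Sum>i\<in>{1..N}. (if i \<in> G then c i else 0) * g i x)"
      unfolding f using G by (intro ext sum.mono_neutral_cong_left) auto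
    then show "f \<in> lin_span {1..N} g"
      unfolding lin_span_def mem_Collect_eq
      by (rule exI[of _ "\<lambda>i. if i \<in> G then c i else 0"])
  qed
qed (simp add: Sigma_sparse_def sys_span_def lin_span_def)

text \<open>Sparse sets prescribe exactly \<open>v\<close> indices, so a smaller support is padded
  by zero coefficients, up to all of \<open>{1..N}\<close> when \<open>v\<close> exceeds
  \<open>N\<close>.\<close>

lemma lincomb_in_Sigma_sparse:
  assumes "G \<subseteq> {1..N}" "card G \<le> v"
  shows "(\<lambda>x. \<Sum>i\<in>G. c i * g i x) \<in> Sigma_sparse N g v"
proof -
  obtain H where H: "G \<subseteq> H" "H \<subseteq> {1..N}" "if v \<le> N then card H = v else H = {1..N}"
  proof (cases "v \<le> N")
    case True
    then have "\<exists>H. G \<subseteq> H \<and> H \<subseteq> {1..N} \<and> card H = v"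
      using assms by (intro exists_subset_between) auto
    then show thesis using True that by auto
  next
    case False
    then show thesis using assms that[of "{1..N}"] by simp
  qed
  have "(\<lambda>x. \<Sum>i\<in>G. c i * g i x) = (\<lambda>x. \<Sum>i\<in>H. (if i \<in> G then c i else 0) * g i x)"
    using H by (intro ext sum.mono_neutral_cong_left) (auto intro: finite_subset)
  then have "\<exists>d. (\<lambda>x. \<Sum>i\<in>G. c i * g i x) = (\<lambda>x. \<Sum>i\<in>H. d i * g i x)"
    by (rule exI[of _ "\<lambda>i. if i \<in> G then c i else 0"])
  then show ?thesis
    using H(2,3) by (auto simp: Sigma_sparse_def sys_span_def split: if_splits)
qed

text \<open>The union of two supports of size \<open>v\<close> has at most \<open>2 * v\<close>
  indices; padding then also handles the case \<open>2 * v > N\<close>.\<close>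

lemma scaled_diff_in_Sigma_sparse:
  assumes "v \<le> N" "f \<in> Sigma_sparse N g v" "h \<in> Sigma_sparse N g v"
  shows "(\<lambda>x. k * (f x - h x)) \<in> Sigma_sparse N g (2 * v)"
proof -
  obtain G c where G: "G \<subseteq> {1..N}" "card G = v" and f: "f = (\<lambda>x. \<Sum>i\<in>G. c i * g i x)"
    using assms by (auto simp: Sigma_sparse_def)
  obtain H d where H: "H \<subseteq> {1..N}" "card H = v" and h: "h = (\<lambda>x. \<Sum>i\<in>H. d i * g i x)"
    using assms by (auto simp: Sigma_sparse_def)
  have fin: "finite (G \<union> H)" using G H by (auto intro: finite_subset)
  have "f = (\<lambda>x. \<Sum>i\<in>G \<union> H. (if i \<in> G then c i else 0) * g i x)"
    unfolding f using fin by (intro ext sum.mono_neutral_cong_left) auto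
  moreover have "h = (\<lambda>x. \<Sum>i\<in>G \<union> H. (if i \<in> H then d i else 0) * g i x)"
    unfolding h using fin by (intro ext sum.mono_neutral_cong_left) auto
  ultimately have "(\<lambda>x. k * (f x - h x)) = (\<lambda>x. \<Sum>i\<in>G \<union> H.
      (k * ((if i \<in> G then c i else 0) - (if i \<in> H then d i else 0))) * g i x)"
    by (simp add: sum_subtractf[symmetric] sum_distrib_left left_diff_distrib mult.assoc)
  also have "\<dots> \<in> Sigma_sparse N g (2 * v)"
    using G H card_Un_le[of G H] by (intro lincomb_in_Sigma_sparse) auto
  finally show ?thesis .
qed

context prob_space
begin

text \<open>Points of \<open>A\<close> are classified by a centre \<open>h\<close> of the coarse cover together with a centre of the
  cover of \<open>S\<close> close to the rescaled difference; one point of each class is kept as a new centre.\<close>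

lemma finite_cover_refine:
  assumes q: "1 \<le> q" and A: "A \<subseteq> Lr_space M q" and S: "S \<subseteq> Lr_space M q"
    and C: "finite_cover M q R A C" and D: "finite_cover M q \<tau> S D"
    and L: "0 < L" "2 * L * \<tau> \<le> t"
    and diff: "\<And>f h. f \<in> A \<Longrightarrow> h \<in> A \<Longrightarrow> Lr_norm M q (\<lambda>x. f x - h x) \<le> R \<Longrightarrow>
      (\<lambda>x. 1 / L * (f x - h x)) \<in> S"
  shows "\<exists>C'. finite_cover M q t A C' \<and> card C' \<le> card D * card C"
proof -
  have ex: "\<exists>hk. hk \<in> C \<times> D \<and> Lr_norm M q (\<lambda>x. 1 / L * (f x - fst hk x) - snd hk x) \<le> \<tau>"
    if f: "f \<in> A" for f
  proof -
    obtain h where h: "h \<in> C" "Lr_norm M q (\<lambda>x. f x - h x) \<le> R"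
      using C f by (auto simp: finite_cover_def)
    then have "h \<in> A" using C by (auto simp: finite_cover_def)
    then obtain k where "k \<in> D" "Lr_norm M q (\<lambda>x. 1 / L * (f x - h x) - k x) \<le> \<tau>"
      using diff[OF f _ h(2)] D by (auto simp: finite_cover_def)
    then show ?thesis using h by (intro exI[of _ "(h, k)"]) auto
  qed
  obtain key where "\<forall>f\<in>A. key f \<in> C \<times> D \<and>
      Lr_norm M q (\<lambda>x. 1 / L * (f x - fst (key f) x) - snd (key f) x) \<le> \<tau>"
    using bchoice[OF ballI[OF ex]] ..
  then have key: "\<And>f. f \<in> A \<Longrightarrow> key f \<in> C \<times> D"
    "\<And>f. f \<in> A \<Longrightarrow> Lr_norm M q (\<lambda>x. 1 / L * (f x - fst (key f) x) - snd (key f) x) \<le> \<tau>"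
    by auto
  obtain C' where C': "C' \<subseteq> A" "inj_on key C'" "key ` A = key ` C'"
    using subset_image_inj[of "key ` A" key A] by auto
  have finCD: "finite (C \<times> D)" using C D by (simp add: finite_cover_def)
  have sub: "key ` C' \<subseteq> C \<times> D" using key(1) C'(1) by blast
  have fin: "finite C'" using inj_on_finite[OF C'(2) sub finCD] .
  have card: "card C' \<le> card D * card C"
    using card_inj_on_le[OF C'(2) sub finCD] by (simp add: card_cartesian_product mult.commute)
  have "\<exists>f'\<in>C'. Lr_norm M q (\<lambda>x. f x - f' x) \<le> t" if f: "f \<in> A" for f
  proof -
    obtain f' where f': "f' \<in> C'" "key f' = key f"
      using f C'(3) by (metis imageE imageI)
    then have "f' \<in> A" using C' by auto
    define h k where "h = fst (key f)" and "k = snd (key f)"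
    have "h \<in> A" "k \<in> S"
      using key(1)[OF f] C D by (auto simp: h_def k_def finite_cover_def)
    define r where "r = (\<lambda>u x. 1 / L * (u x - h x) - k x)"
    have r: "r u \<in> Lr_space M q" if "u \<in> A" for u
      unfolding r_def using that \<open>h \<in> A\<close> \<open>k \<in> S\<close> A S by (intro Lr_diff Lr_scale q) auto
    have rf: "Lr_norm M q (r f) \<le> \<tau>"
      using key(2)[OF f] by (simp add: r_def h_def k_def)
    have rf': "Lr_norm M q (r f') \<le> \<tau>"
      using key(2)[OF \<open>f' \<in> A\<close>] by (simp add: r_def h_def k_def f'(2))
    \<comment> \<open>Equal keys mean a common \<open>h\<close> and \<open>k\<close>, which cancel.
      Only two errors of size at most \<open>\<tau>\<close> remain, scaled by \<open>L\<close>;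
      hence the bound \<open>2 * L * \<tau>\<close>.\<close>
    have "(\<lambda>x. f x - f' x) = (\<lambda>x. L * (r f x - r f' x))"
      using L by (auto simp: r_def field_simps)
    then have "Lr_norm M q (\<lambda>x. f x - f' x) \<le> L * Lr_norm M q (\<lambda>x. r f x - r f' x)"
      using Lr_scale(2)[OF q Lr_diff(1)[OF q r[OF f] r[OF \<open>f' \<in> A\<close>]], of L] L by simp
    also have "\<dots> \<le> L * (\<tau> + \<tau>)"
      using Lr_diff(2)[OF q r[OF f] r[OF \<open>f' \<in> A\<close>]] rf rf' L by (intro mult_left_mono) auto
    also have "\<dots> \<le> t" using L by (simp add: algebra_simps)
    finally show ?thesis using f' by blast
  qed
  then show ?thesis using fin card C' unfolding finite_cover_def by blast
qed

end

subsection \<open>Entropy of sparse balls\<close>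

context prob_space
begin

text \<open>The divisor is the interpolation bound for the difference, with 2 (two unit balls) as
  its \<open>L\<^sub>p\<close> bound and \<open>R\<close> as its \<open>L\<^sub>q\<close>
  bound.\<close>

lemma scaled_difference_in_Sigma_ball:
  assumes p: "1 \<le> p" "p < 2" and q: "2 < q"
    and g: "\<And>i. i \<in> {1..N} \<Longrightarrow> g i \<in> Lr_space M q"
    and \<theta>: "\<theta> = (1 / 2 - enn2real (1 / q)) / (enn2real (1 / p) - enn2real (1 / q))"
    and v: "v \<le> N" and R: "0 < R"
    and f: "f \<in> Sigma_ball M p N g v" and h: "h \<in> Sigma_ball M p N g v"
    and fh: "Lr_norm M q (\<lambda>x. f x - h x) \<le> R"
  shows "(\<lambda>x. 1 / (2 powr \<theta> * R powr (1 - \<theta>)) * (f x - h x)) \<in> Sigma_ball M 2 N g (2 * v)"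
proof -
  define L where "L = 2 powr \<theta> * R powr (1 - \<theta>)"
  have L: "0 < L" using R by (simp add: L_def)
  have "2 \<le> q" using q by simp
  then have q1: "1 \<le> q" "2 \<le> q" using order_trans[OF one_le_numeral] by blast+
  have in_Lq: "u \<in> Lr_space M q" if "u \<in> lin_span {1..N} g" for u
    by (rule lin_span_Lr[OF q1(1) _ _ that]) (use g in auto)
  have "f \<in> lin_span {1..N} g" "h \<in> lin_span {1..N} g"
    using f h Sigma_sparse_subset_lin_span unfolding Sigma_ball_def by blast+
  then have d: "(\<lambda>x. f x - h x) \<in> Lr_space M q"
    using in_Lq by (intro Lr_diff q1)
  then have d2: "(\<lambda>x. f x - h x) \<in> Lr_space M 2"
    using Lr_space_mono[OF _ q1(2)] by simp
  have "Lr_norm M p (\<lambda>x. f x - h x) \<le> 2"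
    using Lr_diff(2)[OF p(1), of f h] f h by (simp add: Sigma_ball_def)
  then have "Lr_norm M 2 (\<lambda>x. f x - h x) \<le> L"
    unfolding L_def using R fh by (intro Lr_norm_interpolation[OF p q \<theta> d]) auto
  then have "Lr_norm M 2 (\<lambda>x. 1 / L * (f x - h x)) \<le> 1 / L * L"
    using Lr_scale(2)[OF _ d2, of "1 / L"] L
    by (intro order_trans[OF _ mult_left_mono[of _ L "1 / L"]]) auto
  then have "Lr_norm M 2 (\<lambda>x. 1 / L * (f x - h x)) \<le> 1"
    using L by simp
  moreover have "(\<lambda>x. 1 / L * (f x - h x)) \<in> Lr_space M 2"
    by (rule Lr_scale(1)[OF _ d2]) simp
  moreover have "(\<lambda>x. 1 / L * (f x - h x)) \<in> Sigma_sparse N g (2 * v)"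
    using f h by (intro scaled_diff_in_Sigma_sparse v) (auto simp: Sigma_ball_def)
  ultimately show ?thesis by (simp add: Sigma_ball_def L_def)
qed

text \<open>With \<open>\<parallel>f\<parallel>\<^sub>q \<le> K \<parallel>f\<parallel>\<^sub>2\<close> on the span, the interpolation inequality gives
  \<open>\<parallel>f\<parallel>\<^sub>q \<le> K \<parallel>f\<parallel>\<^sub>q powr (1 - \<theta>)\<close> when \<open>\<parallel>f\<parallel>\<^sub>p \<le> 1\<close>.\<close>

lemma Sigma_ball_bounded:
  assumes p: "1 \<le> p" "p < 2" and q: "2 < q"
    and g: "\<And>i. i \<in> {1..N} \<Longrightarrow> g i \<in> Lr_space M q"
    and \<theta>: "\<theta> = (1 / 2 - enn2real (1 / q)) / (enn2real (1 / p) - enn2real (1 / q))"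
  shows "\<exists>B. \<forall>f\<in>Sigma_ball M p N g v. Lr_norm M q f \<le> B"
proof -
  have "2 \<le> q" using q by simp
  then have q1: "1 \<le> q" "2 \<le> q" using order_trans[OF one_le_numeral] by blast+
  have in_Lq: "u \<in> Lr_space M q" if "u \<in> lin_span {1..N} g" for u
    by (rule lin_span_Lr[OF q1(1) _ _ that]) (use g in auto)
  have \<theta>0: "0 < \<theta>" using interpolation_exponents[OF p q \<theta>] by simp
  obtain K where K: "0 < K" "\<And>f. f \<in> lin_span {1..N} g \<Longrightarrow> Lr_norm M q f \<le> K * Lr_norm M 2 f"
    using Lr_norm_le_L2_norm_on_span[of q "{1..N}" g] q1 g by (metis finite_atLeastAtMost)
  have "Lr_norm M q f \<le> K powr (1 / \<theta>)" if f: "f \<in> Sigma_ball M p N g v" for f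
  proof (cases "Lr_norm M q f = 0")
    case False
    have fs: "f \<in> lin_span {1..N} g"
      using f Sigma_sparse_subset_lin_span unfolding Sigma_ball_def by blast
    then have fq: "f \<in> Lr_space M q" by (rule in_Lq)
    define b where "b = Lr_norm M q f"
    have b: "0 < b" using False Lr_norm_nonneg[OF fq] by (simp add: b_def)
    have "b \<le> K * Lr_norm M 2 f"
      unfolding b_def by (rule K(2)[OF fs])
    also have "\<dots> \<le> K * (1 powr \<theta> * b powr (1 - \<theta>))"
      using f b K(1) by (intro mult_left_mono Lr_norm_interpolation[OF p q \<theta> fq])
        (auto simp: b_def Sigma_ball_def)
    \<comment> \<open>Splitting \<open>b\<close> into two powers allows the positive factor
      \<open>b powr (1 - \<theta>)\<close> to cancel, leaving a bound independent of
      \<open>f\<close>.\<close>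
    finally have "b powr \<theta> * b powr (1 - \<theta>) \<le> K * b powr (1 - \<theta>)"
      using b by (simp add: powr_add[symmetric])
    then have "b powr \<theta> \<le> K" using b by simp
    then have "(b powr \<theta>) powr (1 / \<theta>) \<le> K powr (1 / \<theta>)"
      using \<theta>0 by (intro powr_mono2) auto
    then show ?thesis using b \<theta>0 by (simp add: powr_powr b_def)
  qed simp
  then show ?thesis by blast
qed

lemma zero_in_Sigma_ball: "(\<lambda>x. 0) \<in> Sigma_ball M r N g v"
proof -
  have "(\<lambda>x. \<Sum>i\<in>{}. 0 * g i x) \<in> Sigma_sparse N g v"
    by (rule lincomb_in_Sigma_sparse) auto
  then show ?thesis by (simp add: Sigma_ball_def Lr_zero Lr_norm_zero)
qed

end

text \<open>The powers of \<open>\<epsilon>\<close> combine to \<open>\<epsilon>\<close>. With z =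
  \<theta>/(1 - \<theta>), so that 1/(1 - \<theta>) = 1 + z, the exponent of 2 on the left falls
  short of \<open>s * (1 + z)\<close> by 1 - \<theta> + z, which is positive; the factor
  \<open>2 powr (-3)\<close> pays for the constants of the refinement.\<close>

lemma refinement_scale_le:
  fixes \<theta> a \<epsilon> :: real and s :: nat
  assumes "0 < \<theta>" "\<theta> < 1" "0 < \<epsilon>" and a: "a = 2 powr (\<theta> / (1 - \<theta>))"
  shows "2 * (2 powr \<theta> * (2 powr (real (Suc s) / (1 - \<theta>)) * \<epsilon>) powr (1 - \<theta>)) *
      (2 powr (-3) * a powr (real s - 1) * \<epsilon> powr \<theta>)
    \<le> 2 powr (real s / (1 - \<theta>)) * \<epsilon>"
proof -
  define z where "z = \<theta> / (1 - \<theta>)"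
  have z: "0 < z" "1 / (1 - \<theta>) = 1 + z" using assms by (auto simp: z_def field_simps)
  have e: "\<epsilon> powr (1 - \<theta>) * \<epsilon> powr \<theta> = \<epsilon>"
    using assms by (simp add: powr_add[symmetric])
  have pow: "(2 powr (real (Suc s) / (1 - \<theta>)) * \<epsilon>) powr (1 - \<theta>) = 2 powr (real s + 1) * \<epsilon> powr (1 - \<theta>)"
    using assms by (simp add: powr_mult powr_powr add.commute)
  have ap: "a powr (real s - 1) = 2 powr (z * (real s - 1))"
    by (simp add: a powr_powr z_def)
  have "2 * (2 powr \<theta> * (2 powr (real (Suc s) / (1 - \<theta>)) * \<epsilon>) powr (1 - \<theta>)) *
      (2 powr (-3) * a powr (real s - 1) * \<epsilon> powr \<theta>)
    = 2 powr 1 * 2 powr \<theta> * 2 powr (real s + 1) * 2 powr (-3) * 2 powr (z * (real s - 1)) *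
      (\<epsilon> powr (1 - \<theta>) * \<epsilon> powr \<theta>)"
    unfolding pow ap by (simp only: powr_one mult_ac)
  also have "\<dots> = 2 powr (1 + \<theta> + (real s + 1) + (-3) + z * (real s - 1)) * \<epsilon>"
    unfolding e by (simp only: powr_add)
  also have "\<dots> \<le> 2 powr (real s / (1 - \<theta>)) * \<epsilon>"
  proof (intro mult_right_mono powr_mono)
    have "real s / (1 - \<theta>) = real s * (1 + z)" using z by (metis times_divide_eq_right mult.right_neutral)
    then show "1 + \<theta> + (real s + 1) + (-3) + z * (real s - 1) \<le> real s / (1 - \<theta>)"
      using z assms by (simp add: algebra_simps)
  qed (use assms in auto)
  finally show ?thesis .
qed

text \<open>Both families of radii grow geometrically, so each finally exceeds the size of the ball
  it has to cover; the shift \<open>b\<close> fits either indexing.\<close>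

lemma eventually_ge_powr_scale:
  fixes a b c B :: real
  assumes "1 < a" "0 < c"
  shows "\<exists>s0. \<forall>s\<ge>s0. B \<le> c * a powr (real s - b)"
proof -
  obtain s0 where s0: "B / c * a powr b < a ^ s0"
    using real_arch_pow[OF assms(1)] by blast
  have "B \<le> c * a powr (real s - b)" if "s0 \<le> s" for s
  proof -
    have "B / c * a powr b \<le> a ^ s"
      using s0 power_increasing[OF that, of a] assms by linarith
    then show ?thesis
      using assms by (simp add: powr_diff powr_realpow field_simps)
  qed
  then show ?thesis by blast
qed

text \<open>Summability is asserted along with the estimate because \<open>suminf\<close> is
  meaningful only for a convergent series. The exponent \<open>real s - 1\<close> is a real
  difference, so the series starts with \<open>a\<close> to the power -1.\<close>

theorem lemma3p1:
  fixes M :: "'a measure" and p q :: ennreal and N v :: nat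
    and g :: "nat \<Rightarrow> 'a \<Rightarrow> real" and \<theta> a \<epsilon> :: real
  assumes "prob_space M"
    and "1 \<le> p" and "p < 2" and "2 < q"
    and "\<And>i. i \<in> {1..N} \<Longrightarrow> g i \<in> Lr_space M q"
    and "\<theta> = (1 / 2 - enn2real (1 / q)) / (enn2real (1 / p) - enn2real (1 / q))"
    and "a = 2 powr (\<theta> / (1 - \<theta>))"
    and "v \<in> {1..N}" and "\<epsilon> > 0"
  shows "summable (\<lambda>s. metric_entropy M q (2 powr (-3) * a powr (real s - 1) * \<epsilon> powr \<theta>)
             (Sigma_ball M 2 N g (2 * v)))
       \<and> metric_entropy M q \<epsilon> (Sigma_ball M p N g v)
         \<le> (\<Sum>s. metric_entropy M q (2 powr (-3) * a powr (real s - 1) * \<epsilon> powr \<theta>)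
               (Sigma_ball M 2 N g (2 * v)))
           + metric_entropy M q (\<epsilon> powr \<theta>) (Sigma_ball M 2 N g (2 * v))"
proof -
  interpret prob_space M by fact
  note p = assms(2,3) and q = assms(4) and g = assms(5) and \<theta> = assms(6) and \<epsilon> = assms(9)
  have "2 \<le> q" using q by simp
  then have q1: "1 \<le> q" "2 \<le> q" using order_trans[OF one_le_numeral] by blast+
  have in_Lq: "u \<in> Lr_space M q" if "u \<in> lin_span {1..N} g" for u
    by (rule lin_span_Lr[OF q1(1) _ _ that]) (use g in auto)
  have \<theta>01: "0 < \<theta>" "\<theta> < 1" using interpolation_exponents[OF p q \<theta>] by auto
  have a1: "1 < a" using \<theta>01 assms(7) by simp
  define A S where "A = Sigma_ball M p N g v" and "S = Sigma_ball M 2 N g (2 * v)"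
  define \<tau> where "\<tau> s = 2 powr (-3) * a powr (real s - 1) * \<epsilon> powr \<theta>" for s :: nat
  \<comment> \<open>Radii of the successive covers of \<open>A\<close>: \<open>e 0\<close> is
    \<open>\<epsilon>\<close>, and the growth rate is such that a cover at radius
    \<open>e (Suc s)\<close>, refined with accuracy \<open>\<tau> s\<close>, becomes one at radius
    \<open>e s\<close>.\<close>
  define e where "e s = 2 powr (real s / (1 - \<theta>)) * \<epsilon>" for s :: nat
  define H where "H s = metric_entropy M q (\<tau> s) S" for s
  have \<tau>: "0 < \<tau> s" for s using a1 \<epsilon> by (simp add: \<tau>_def)
  have e: "0 < e s" for s using \<epsilon> by (simp add: e_def)
  have span: "A \<subseteq> lin_span {1..N} g" "S \<subseteq> lin_span {1..N} g"
    using Sigma_sparse_subset_lin_span unfolding A_def S_def Sigma_ball_def by blast+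
  have Lq: "A \<subseteq> Lr_space M q" "S \<subseteq> Lr_space M q"
    using span in_Lq by blast+
  have zero: "(\<lambda>x. 0) \<in> A" "(\<lambda>x. 0) \<in> S"
    by (simp_all add: A_def S_def zero_in_Sigma_ball)
  then have ne: "A \<noteq> {}" "S \<noteq> {}" by auto
  have S2: "Lr_norm M 2 f \<le> 1" if "f \<in> S" for f
    using that by (simp add: S_def Sigma_ball_def)
  have coverS: "\<exists>D. finite_cover M q t S D" if "0 < t" for t
    using lin_span_totally_bounded[of q "{1..N}" g S 1 t] q1 g span S2 that by auto
  have H0: "0 \<le> metric_entropy M q t S" if "0 < t" for t
  proof -
    have "1 \<le> covering_number M q t S"
      using coverS[OF that] covering_number_pos[OF _ Lq(2) ne(2)] by blast
    then show ?thesis by (simp add: metric_entropy_def)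
  qed

  \<comment> \<open>Vanishing of all but finitely many terms of the series\<close>
  obtain K where "0 < K" "\<And>f. f \<in> lin_span {1..N} g \<Longrightarrow> Lr_norm M q f \<le> K * Lr_norm M 2 f"
    using Lr_norm_le_L2_norm_on_span[of q "{1..N}" g] q1 g by (metis finite_atLeastAtMost)
  then have SK: "Lr_norm M q f \<le> K" if "f \<in> S" for f
    using order_trans[OF _ mult_left_mono[OF S2[OF that], of K]] subsetD[OF span(2) that] by simp
  \<comment> \<open>Once \<open>\<tau> s\<close> reaches \<open>K\<close>, a single ball around 0
    covers \<open>S\<close> and the entropy is \<open>log 2 1 = 0\<close>.\<close>
  obtain s0 where s0: "\<forall>s\<ge>s0. K \<le> 2 powr (-3) * \<epsilon> powr \<theta> * a powr (real s - 1)"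
    using eventually_ge_powr_scale[OF a1, of "2 powr (-3) * \<epsilon> powr \<theta>" K 1] \<epsilon> by auto
  have H_eq_0: "H s = 0" if "s0 \<le> s" for s
  proof -
    have "K \<le> \<tau> s" using s0 that by (simp add: \<tau>_def mult_ac)
    then have "finite_cover M q (\<tau> s) S {\<lambda>x. 0}"
      using SK by (intro finite_cover_zero zero) force
    then have "covering_number M q (\<tau> s) S = 1"
      using covering_number_le_card[OF _ Lq(2)] covering_number_pos[OF _ Lq(2) ne(2)] by fastforce
    then show ?thesis by (simp add: H_def metric_entropy_def)
  qed
  have sum: "summable H"
    by (rule summable_finite[of "{..<s0}"]) (auto simp: H_eq_0)

  \<comment> \<open>Descends from radius \<open>e n\<close> to \<open>e 0\<close>, paying
    \<open>H\<close> once per level. The cover changes at every level, so the induction is over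
    arbitrary \<open>C\<close>.\<close>
  have chain: "\<exists>C'. finite_cover M q \<epsilon> A C' \<and> log 2 (card C') \<le> (\<Sum>s<n. H s) + log 2 (card C)"
    if "finite_cover M q (e n) A C" for n C
    using that
  proof (induction n arbitrary: C)
    case 0
    then show ?case by (auto simp: e_def)
  next
    case (Suc n)
    obtain D\<^sub>0 where "finite_cover M q (\<tau> n) S D\<^sub>0" using coverS[OF \<tau>] by blast
    then obtain D where D: "finite_cover M q (\<tau> n) S D" "card D \<le> covering_number M q (\<tau> n) S"
      using ex_finite_cover_card_le_covering_number[OF _ Lq(2)] by blast
    define L where "L = 2 powr \<theta> * e (Suc n) powr (1 - \<theta>)"
    have L: "0 < L" "2 * L * \<tau> n \<le> e n"
      subgoal using e[of "Suc n"] by (simp add: L_def)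
      subgoal unfolding L_def e_def \<tau>_def by (rule refinement_scale_le[OF \<theta>01 \<epsilon> assms(7)])
      done
    have "\<exists>C'. finite_cover M q (e n) A C' \<and> card C' \<le> card D * card C"
    proof (rule finite_cover_refine[OF q1(1) Lq Suc.prems D(1) L])
      fix f h assume "f \<in> A" "h \<in> A" "Lr_norm M q (\<lambda>x. f x - h x) \<le> e (Suc n)"
      then show "(\<lambda>x. 1 / L * (f x - h x)) \<in> S"
        unfolding A_def S_def L_def using assms(8)
        by (intro scaled_difference_in_Sigma_ball[OF p q g \<theta> _ e]) auto
    qed
    then obtain C' where C': "finite_cover M q (e n) A C'" "card C' \<le> card D * card C"
      by blast
    \<comment> \<open>Positive cardinalities are required for monotonicity of the logarithm and for
      splitting it over the product.\<close>
    have pos: "1 \<le> card C'" "1 \<le> card D" "1 \<le> card C"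
      using C' Suc.prems D(1) finite_cover_card_pos ne by blast+
    have "real (card C') \<le> real (covering_number M q (\<tau> n) S) * real (card C)"
      using order_trans[OF C'(2) mult_right_mono[OF D(2)]] by (simp flip: of_nat_mult)
    then have "log 2 (card C') \<le> log 2 (real (covering_number M q (\<tau> n) S) * real (card C))"
      using pos by (intro log_mono) auto
    also have "\<dots> = H n + log 2 (card C)"
      using pos D(2) by (simp add: H_def metric_entropy_def log_mult)
    finally show ?case
      using Suc.IH[OF C'(1)] by fastforce
  qed

  \<comment> \<open>The descent starts at a radius \<open>e n\<close> beyond the
    \<open>L\<^sub>q\<close> bound of \<open>A\<close>, where the cover is a single ball around 0
    and contributes \<open>log 2 1 = 0\<close>.\<close>
  obtain B where B: "\<forall>f\<in>A. Lr_norm M q f \<le> B"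
    using Sigma_ball_bounded[of p q N g, OF p q g \<theta>] unfolding A_def by blast
  have "1 < 2 powr (1 / (1 - \<theta>))" using \<theta>01 by simp
  then obtain n where "B \<le> \<epsilon> * (2 powr (1 / (1 - \<theta>))) powr (real n - 0)"
    using eventually_ge_powr_scale[OF _ \<epsilon>] by blast
  then have "B \<le> e n" by (simp add: e_def powr_powr mult.commute)
  then have "finite_cover M q (e n) A {\<lambda>x. 0}"
    using B by (intro finite_cover_zero zero) force
  then obtain C where C: "finite_cover M q \<epsilon> A C" "log 2 (card C) \<le> (\<Sum>s<n. H s)"
    using chain by fastforce
  have "metric_entropy M q \<epsilon> A \<le> log 2 (card C)"
    unfolding metric_entropy_def
    using covering_number_le_card[OF C(1) Lq(1)] covering_number_pos[OF C(1) Lq(1) ne(1)]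
    by (intro log_mono) auto
  also have "\<dots> \<le> (\<Sum>s<n. H s)" by (rule C(2))
  also have "\<dots> \<le> (\<Sum>s. H s)"
    using H0[OF \<tau>] unfolding H_def[symmetric] by (intro sum_le_suminf sum) auto
  also have "\<dots> \<le> (\<Sum>s. H s) + metric_entropy M q (\<epsilon> powr \<theta>) S"
    using H0[of "\<epsilon> powr \<theta>"] \<epsilon> by simp
  finally show ?thesis
    using sum unfolding H_def \<tau>_def A_def S_def by blast
qed

end
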